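(* Let $\mathcal{F}_0$ be a transversely oriented codimension one foliation on a smooth manifold $M$ with a transversely homographic structure. Then for all germs at $t=0$ of smooth $1$-parameter families $\mathcal{F}_t$ of codimension one foliations based at $\mathcal{F}_0$ we have $T(\mathcal{F}_t)(0)=0\in H^3(\mathcal{I}(\mathcal{F}_0))$.
   Context: All manifolds, foliations, forms and families are of class $C^\infty$; a dot denotes the derivative with respect to $t$. A defining form of a transversely oriented codimension one foliation $\mathcal{F}$ is a nowhere vanishing $1$-form $\alpha$ with $\ker\alpha=T\mathcal{F}$, positive on positively oriented transversals. There exist $1$-forms $\beta,\gamma,\delta$ (not unique) with $d\alpha=\alpha\wedge\beta$, $d\beta=\alpha\wedge\gamma$, $d\gamma=\beta\wedge\gamma+\alpha\wedge\delta$. A codimension one foliation has a transversely homographic structure if it has a defining form $\alpha$ for which $\delta$ can be taken to be zero, i.e. there are $\beta,\gamma$ with $d\alpha=\alpha\wedge\beta$, $d\beta=\alpha\wedge\gamma$, $d\gamma=\beta\wedge\gamma$. $\mathcal{I}(\mathcal{F})\subset\Omega^*(M)$ is the graded differential ideal of forms vanishing on $T\mathcal{F}$ (i.e. on all tuples of vectors tangent to $\mathcal{F}$), with cohomology $H^*(\mathcal{I}(\mathcal{F}))$. For a smooth family $\mathcal{F}_t$ with smooth families of defining forms $\alpha(t)$ and of $1$-forms $\beta(t)$ satisfying $d\alpha=\alpha\wedge\beta$, the $3$-form $(\dot\beta\wedge d\beta)(t)$ is a closed element of $\mathcal{I}(\mathcal{F}_t)$ whose class $T(\mathcal{F}_t)\in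 H^3(\mathcal{I}(\mathcal{F}_t))$ is independent of the choices; $T(\mathcal{F}_t)(0)$ denotes this class at $t=0$. *)

theory Defs
  imports "HOL-Analysis.Analysis" "HOL-Combinatorics.Permutations"
begin

fun Ck_on :: "nat \<Rightarrow> 'a::real_normed_vector set \<Rightarrow> ('a \<Rightarrow> 'b::real_normed_vector) \<Rightarrow> bool" where
  "Ck_on 0 S f \<longleftrightarrow> continuous_on S f"
| "Ck_on (Suc k) S f \<longleftrightarrow> (\<forall>x\<in>S. f differentiable (at x)) \<and>
      (\<forall>v. Ck_on k S (\<lambda>x. frechet_derivative f (at x) v))"

text \<open>Only meant for open sets \<open>S\<close>, since the derivatives are not taken within \<open>S\<close>.\<close>

definition smooth_on :: "'a::real_normed_vector set \<Rightarrow> ('a \<Rightarrow> 'b::real_normed_vector) \<Rightarrow> bool" where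
  "smooth_on S f \<longleftrightarrow> (\<forall>k. Ck_on k S f)"


section \<open>Manifolds\<close>

text \<open>A manifold is a Hausdorff, second countable type \<open>'m\<close> with a smooth atlas modelled on the
  Euclidean space \<open>'e\<close>; its dimension is \<open>DIM('e)\<close>. A chart is a pair of a domain and a
  coordinate map, whose values outside the domain are irrelevant.\<close>

type_synonym ('m, 'e) chart = "'m set \<times> ('m \<Rightarrow> 'e)"

abbreviation cdom :: "('m, 'e) chart \<Rightarrow> 'm set" where
  "cdom c \<equiv> fst c"

abbreviation coord :: "('m, 'e) chart \<Rightarrow> 'm \<Rightarrow> 'e" where
  "coord c \<equiv> snd c"

definition ctarget :: "('m, 'e) chart \<Rightarrow> 'e set" where
  "ctarget c = coord c ` cdom c"

definition param :: "('m, 'e) chart \<Rightarrow> 'e \<Rightarrow> 'm" where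
  "param c = inv_into (cdom c) (coord c)"

definition is_chart ::
    "('m::topological_space, 'e::euclidean_space) chart \<Rightarrow> bool" where
  "is_chart c \<longleftrightarrow> open (cdom c) \<and> open (ctarget c) \<and>
     homeomorphism (cdom c) (ctarget c) (coord c) (param c)"

definition smooth_atlas ::
    "('m::{t2_space,second_countable_topology}, 'e::euclidean_space) chart set \<Rightarrow> bool" where
  "smooth_atlas A \<longleftrightarrow> (\<forall>c\<in>A. is_chart c) \<and> (\<Union>c\<in>A. cdom c) = UNIV \<and>
     (\<forall>c\<in>A. \<forall>c'\<in>A. smooth_on (coord c ` (cdom c \<inter> cdom c')) (coord c' \<circ> param c))"


section \<open>Differential forms\<close>

text \<open>A differential form is a family of local representatives, one for each chart \<open>c\<close> of the
  atlas, living on the open set \<open>ctarget c\<close> and related by pullback along the changes of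
  coordinates. The value of the representative at a coordinate point \<open>x\<close> on tangent vectors
  \<open>v 0, \<dots>, v (k - 1)\<close> is \<open>\<omega> c x v\<close>, where the remaining entries of \<open>v\<close> do not matter. The
  representatives are zero off their domains, so that equality of forms is plain equality.\<close>

type_synonym ('m, 'e) form = "('m, 'e) chart \<Rightarrow> 'e \<Rightarrow> (nat \<Rightarrow> 'e) \<Rightarrow> real"

definition alternating_form :: "nat \<Rightarrow> ((nat \<Rightarrow> 'e::real_vector) \<Rightarrow> real) \<Rightarrow> bool" where
  "alternating_form k a \<longleftrightarrow>
     (\<forall>v w. (\<forall>i<k. v i = w i) \<longrightarrow> a v = a w) \<and>
     (\<forall>i<k. \<forall>v. linear (\<lambda>u. a (v(i := u)))) \<and>
     (\<forall>v i j. i < j \<and> j < k \<and> v i = v j \<longrightarrow> a v = 0)"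

definition is_form ::
    "('m::topological_space, 'e::euclidean_space) chart set \<Rightarrow> nat \<Rightarrow> ('m, 'e) form \<Rightarrow> bool" where
  "is_form A k \<omega> \<longleftrightarrow>
     (\<forall>c\<in>A. \<forall>x\<in>ctarget c. alternating_form k (\<omega> c x)) \<and>
     (\<forall>c\<in>A. \<forall>v. smooth_on (ctarget c) (\<lambda>x. \<omega> c x v)) \<and>
     (\<forall>c\<in>A. \<forall>c'\<in>A. \<forall>x\<in>coord c ` (cdom c \<inter> cdom c'). \<forall>v.
        \<omega> c x v = \<omega> c' (coord c' (param c x))
          (\<lambda>i. frechet_derivative (coord c' \<circ> param c) (at x) (v i))) \<and>
     (\<forall>c x v. c \<notin> A \<or> x \<notin> ctarget c \<longrightarrow> \<omega> c x v = 0)"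

definition zero_form :: "('m, 'e) form" where
  "zero_form = (\<lambda>c x v. 0)"

text \<open>Normalised so that \<open>(\<alpha> \<and> \<beta>)(u, w) = \<alpha>(u) \<beta>(w) - \<alpha>(w) \<beta>(u)\<close> for 1-forms; correspondingly
  \<open>d\<alpha>\<close> below is \<open>(u, w) \<mapsto> D\<^sub>u(\<alpha>(w)) - D\<^sub>w(\<alpha>(u))\<close> on constant vectors.\<close>

definition wedge :: "nat \<Rightarrow> nat \<Rightarrow> ('m, 'e) form \<Rightarrow> ('m, 'e) form \<Rightarrow> ('m, 'e) form" where
  "wedge k l \<omega> \<eta> = (\<lambda>c x v.
     (\<Sum>\<sigma> | \<sigma> permutes {..<k + l}.
        of_int (sign \<sigma>) * \<omega> c x (\<lambda>i. v (\<sigma> i)) * \<eta> c x (\<lambda>i. v (\<sigma> (k + i))))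
     / (fact k * fact l))"

definition ext_d ::
    "('m, 'e::euclidean_space) chart set \<Rightarrow> nat \<Rightarrow> ('m, 'e) form \<Rightarrow> ('m, 'e) form" where
  "ext_d A k \<omega> = (\<lambda>c x v.
     if c \<in> A \<and> x \<in> ctarget c
     then \<Sum>i\<le>k. (-1) ^ i *
            frechet_derivative (\<lambda>y. \<omega> c y (\<lambda>j. v (if j < i then j else Suc j))) (at x) (v i)
     else 0)"


section \<open>Transversely oriented codimension one foliations\<close>

text \<open>A foliation is given by a cocycle of distinguished submersions \<open>f : U \<rightarrow> \<real>\<close>, whose level
  sets are the plaques and which differ on overlaps locally by orientation preserving
  diffeomorphisms between open subsets of the line.\<close>

type_synonym 'm foliation = "('m set \<times> ('m \<Rightarrow> real)) set"

definition submersion_on ::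
    "('m::topological_space, 'e::euclidean_space) chart set \<Rightarrow> 'm set \<Rightarrow> ('m \<Rightarrow> real) \<Rightarrow> bool" where
  "submersion_on A U f \<longleftrightarrow> (\<forall>c\<in>A.
     smooth_on (coord c ` (cdom c \<inter> U)) (f \<circ> param c) \<and>
     (\<forall>x\<in>coord c ` (cdom c \<inter> U). \<exists>v. frechet_derivative (f \<circ> param c) (at x) v \<noteq> 0))"

definition is_foliation ::
    "('m::topological_space, 'e::euclidean_space) chart set \<Rightarrow> 'm foliation \<Rightarrow> bool" where
  "is_foliation A F \<longleftrightarrow>
     (\<forall>(U, f)\<in>F. open U \<and> submersion_on A U f) \<and> (\<Union>(U, f)\<in>F. U) = UNIV \<and>
     (\<forall>(U, f)\<in>F. \<forall>(V, g)\<in>F. \<forall>p\<in>U \<inter> V. \<exists>W h. open W \<and> p \<in> W \<and> W \<subseteq> U \<inter> V \<and>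
        smooth_on (f ` W) h \<and> (\<forall>s\<in>f ` W. deriv h s > 0) \<and> (\<forall>q\<in>W. g q = h (f q)))"

definition leaf_tangent ::
    "'m foliation \<Rightarrow> ('m, 'e::euclidean_space) chart \<Rightarrow> 'e \<Rightarrow> 'e \<Rightarrow> bool" where
  "leaf_tangent F c x v \<longleftrightarrow>
     (\<exists>(U, f)\<in>F. param c x \<in> U \<and> frechet_derivative (f \<circ> param c) (at x) v = 0)"

definition pos_transverse ::
    "'m foliation \<Rightarrow> ('m, 'e::euclidean_space) chart \<Rightarrow> 'e \<Rightarrow> 'e \<Rightarrow> bool" where
  "pos_transverse F c x v \<longleftrightarrow>
     (\<exists>(U, f)\<in>F. param c x \<in> U \<and> frechet_derivative (f \<circ> param c) (at x) v > 0)"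

definition defining_form ::
    "('m::topological_space, 'e::euclidean_space) chart set \<Rightarrow> 'm foliation \<Rightarrow> ('m, 'e) form \<Rightarrow> bool"
  where
  "defining_form A F \<alpha> \<longleftrightarrow> is_form A 1 \<alpha> \<and>
     (\<forall>c\<in>A. \<forall>x\<in>ctarget c.
        (\<exists>v. \<alpha> c x (\<lambda>_. v) \<noteq> 0) \<and>
        (\<forall>v. \<alpha> c x (\<lambda>_. v) = 0 \<longleftrightarrow> leaf_tangent F c x v) \<and>
        (\<forall>v. pos_transverse F c x v \<longrightarrow> \<alpha> c x (\<lambda>_. v) > 0))"

definition transversely_homographic ::
    "('m::topological_space, 'e::euclidean_space) chart set \<Rightarrow> 'm foliation \<Rightarrow> bool" where
  "transversely_homographic A F \<longleftrightarrow>
     (\<exists>\<alpha> \<beta> \<gamma>. defining_form A F \<alpha> \<and> is_form A 1 \<beta> \<and> is_form A 1 \<gamma> \<and>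
        ext_d A 1 \<alpha> = wedge 1 1 \<alpha> \<beta> \<and>
        ext_d A 1 \<beta> = wedge 1 1 \<alpha> \<gamma> \<and>
        ext_d A 1 \<gamma> = wedge 1 1 \<beta> \<gamma>)"


section \<open>The ideal of a foliation and its cohomology\<close>

definition fol_ideal ::
    "('m::topological_space, 'e::euclidean_space) chart set \<Rightarrow> 'm foliation \<Rightarrow> nat \<Rightarrow> ('m, 'e) form set"
  where
  "fol_ideal A F k = {\<omega>. is_form A k \<omega> \<and>
     (\<forall>c\<in>A. \<forall>x\<in>ctarget c. \<forall>v. (\<forall>i<k. leaf_tangent F c x (v i)) \<longrightarrow> \<omega> c x v = 0)}"

definition ideal_cocycles ::
    "('m::topological_space, 'e::euclidean_space) chart set \<Rightarrow> 'm foliation \<Rightarrow> nat \<Rightarrow> ('m, 'e) form set"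
  where
  "ideal_cocycles A F k = {\<omega> \<in> fol_ideal A F k. ext_d A k \<omega> = zero_form}"

definition ideal_coboundaries ::
    "('m::topological_space, 'e::euclidean_space) chart set \<Rightarrow> 'm foliation \<Rightarrow> nat \<Rightarrow> ('m, 'e) form set"
  where
  "ideal_coboundaries A F k =
     (case k of 0 \<Rightarrow> {zero_form} | Suc j \<Rightarrow> ext_d A j ` fol_ideal A F j)"

definition cohomologous ::
    "('m::topological_space, 'e::euclidean_space) chart set \<Rightarrow> 'm foliation \<Rightarrow> nat
      \<Rightarrow> ('m, 'e) form rel" where
  "cohomologous A F k = {(\<omega>, \<omega>'). \<omega> \<in> ideal_cocycles A F k \<and> \<omega>' \<in> ideal_cocycles A F k \<and>
     (\<lambda>c x v. \<omega> c x v - \<omega>' c x v) \<in> ideal_coboundaries A F k}"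

text \<open>The class of \<open>\<omega>\<close> as an element of the quotient
  \<open>ideal_cocycles A F k // cohomologous A F k\<close>. It is empty, hence different from every
  cohomology class, when \<open>\<omega>\<close> is not a cocycle of the ideal.\<close>

definition coh_class ::
    "('m::topological_space, 'e::euclidean_space) chart set \<Rightarrow> 'm foliation \<Rightarrow> nat
      \<Rightarrow> ('m, 'e) form \<Rightarrow> ('m, 'e) form set" where
  "coh_class A F k \<omega> = cohomologous A F k `` {\<omega>}"


section \<open>Smooth families\<close>

definition smooth_form_family ::
    "('m::topological_space, 'e::euclidean_space) chart set \<Rightarrow> real set \<Rightarrow> nat
      \<Rightarrow> (real \<Rightarrow> ('m, 'e) form) \<Rightarrow> bool" where
  "smooth_form_family A J k \<omega> \<longleftrightarrow> (\<forall>t\<in>J. is_form A k (\<omega> t)) \<and>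
     (\<forall>c\<in>A. \<forall>v. smooth_on (J \<times> ctarget c) (\<lambda>(t, x). \<omega> t c x v))"

definition form_dot :: "(real \<Rightarrow> ('m, 'e) form) \<Rightarrow> real \<Rightarrow> ('m, 'e) form" where
  "form_dot \<omega> t = (\<lambda>c x v. deriv (\<lambda>s. \<omega> s c x v) t)"

definition defining_form_family ::
    "('m::topological_space, 'e::euclidean_space) chart set \<Rightarrow> real set \<Rightarrow> (real \<Rightarrow> 'm foliation)
      \<Rightarrow> (real \<Rightarrow> ('m, 'e) form) \<Rightarrow> bool" where
  "defining_form_family A J F \<alpha> \<longleftrightarrow>
     smooth_form_family A J 1 \<alpha> \<and> (\<forall>t\<in>J. defining_form A (F t) (\<alpha> t))"

text \<open>A family of foliations is smooth if its tangent hyperplane fields are the kernels of a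
  smooth family of 1-forms.\<close>

definition smooth_foliation_family ::
    "('m::topological_space, 'e::euclidean_space) chart set \<Rightarrow> real set \<Rightarrow> (real \<Rightarrow> 'm foliation)
      \<Rightarrow> bool" where
  "smooth_foliation_family A J F \<longleftrightarrow>
     (\<forall>t\<in>J. is_foliation A (F t)) \<and> (\<exists>\<alpha>. defining_form_family A J F \<alpha>)"

text \<open>The choices of \<open>\<alpha>(t)\<close> and \<open>\<beta>(t)\<close> through which the class of the family is computed.\<close>

definition admissible_choice ::
    "('m::topological_space, 'e::euclidean_space) chart set \<Rightarrow> real set \<Rightarrow> (real \<Rightarrow> 'm foliation)
      \<Rightarrow> (real \<Rightarrow> ('m, 'e) form) \<Rightarrow> (real \<Rightarrow> ('m, 'e) form) \<Rightarrow> bool" where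
  "admissible_choice A J F \<alpha> \<beta> \<longleftrightarrow>
     defining_form_family A J F \<alpha> \<and> smooth_form_family A J 1 \<beta> \<and>
     (\<forall>t\<in>J. ext_d A 1 (\<alpha> t) = wedge 1 1 (\<alpha> t) (\<beta> t))"

definition T_class ::
    "('m::topological_space, 'e::euclidean_space) chart set \<Rightarrow> (real \<Rightarrow> 'm foliation)
      \<Rightarrow> (real \<Rightarrow> ('m, 'e) form) \<Rightarrow> real \<Rightarrow> ('m, 'e) form set" where
  "T_class A F \<beta> t = coh_class A (F t) 3 (wedge 1 2 (form_dot \<beta> t) (ext_d A 1 (\<beta> t)))"

end

theory Submission
  imports Defs
begin

text \<open>A primitive of the class can be written down. Let \<open>\<alpha>, \<beta>\<close> be the forms of the family at time 0 and
\<open>\<alpha>', \<beta>'\<close> their time derivatives there, and suppose that for these very \<open>\<alpha>\<close> and \<open>\<beta>\<close> there is a 1-form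
\<open>\<gamma>\<close> with \<open>d\<beta> = \<alpha> \<and> \<gamma>\<close> and \<open>d\<gamma> = \<beta> \<and> \<gamma>\<close>. Differentiating \<open>d\<alpha> = \<alpha> \<and> \<beta>\<close> in time gives
\<open>d\<alpha>' = \<alpha>' \<and> \<beta> + \<alpha> \<and> \<beta>'\<close>, so \<open>\<eta> = d\<beta>' - \<alpha>' \<and> \<gamma>\<close> satisfies

\<open>d\<eta> = - d\<alpha>' \<and> \<gamma> + \<alpha>' \<and> d\<gamma> = - \<alpha> \<and> \<beta>' \<and> \<gamma> = \<beta>' \<and> \<alpha> \<and> \<gamma> = \<beta>' \<and> d\<beta>\<close>.

The summand \<open>d\<beta>'\<close> is closed and contributes nothing here; it is there to put \<open>\<eta>\<close> into the ideal. Indeed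
\<open>\<alpha> \<and> d\<beta> = 0\<close> holds at all times, because \<open>d(d\<alpha>) = 0\<close>, and its time derivative
\<open>\<alpha>' \<and> \<alpha> \<and> \<gamma> + \<alpha> \<and> d\<beta>' = 0\<close> says that \<open>\<alpha> \<and> \<eta> = 0\<close>; as \<open>\<alpha>\<close> has no zeros, \<open>\<eta>\<close> vanishes on its kernel.
These facts are \<open>ext_d_primitive\<close> and \<open>primitive_tangent\<close>.

The homographic structure provides such a \<open>\<gamma>\<close> only for some defining form and some \<open>\<beta>\<close>. Its existence is
independent of both choices: under \<open>\<alpha> \<mapsto> f \<alpha>\<close> one takes \<open>\<gamma> / f\<close>, and under \<open>\<beta> \<mapsto> \<beta> + g \<alpha>\<close> one takes
\<open>\<gamma> - dg + g \<beta> + g\<^sup>2 \<alpha> / 2\<close>. This is \<open>homographic_triple_exists\<close>.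

The calculus behind this rests on one analytic fact, the symmetry of second derivatives
(\<open>mixed_derivatives_commute\<close>): it makes the exterior derivative independent of coordinates, gives it square
zero, and lets it commute with the time derivative.\<close>

section \<open>Functions of class \<open>C\<^sup>k\<close> and their mixed derivatives\<close>

lemma frechet_derivative_cong_open:
  assumes "open S" "x \<in> S" "\<And>y. y \<in> S \<Longrightarrow> f y = g y"
  shows "frechet_derivative f (at x) = frechet_derivative g (at x)"
proof -
  have "(f has_derivative D) (at x) \<longleftrightarrow> (g has_derivative D) (at x)" for D
    using has_derivative_transform_within_open[OF _ assms(1,2)] assms(3) by metis
  then show ?thesis
    by (simp add: frechet_derivative_def)
qed

lemma differentiable_cong_open:
  assumes "open S" "x \<in> S" "\<And>y. y \<in> S \<Longrightarrow> f y = g y" "f differentiable at x"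
  shows "g differentiable at x"
  using has_derivative_transform_within_open[OF _ assms(1,2)] assms(3,4)
  unfolding differentiable_def by metis

lemma frechet_derivative_eqI:
  "(f has_derivative f') (at x) \<Longrightarrow> frechet_derivative f (at x) = f'"
  by (rule frechet_derivative_at[symmetric])

lemma has_derivative_frechet:
  "f differentiable at x \<Longrightarrow> (f has_derivative frechet_derivative f (at x)) (at x)"
  by (simp add: frechet_derivative_works)

lemma Ck_on_cong:
  assumes "open S" "\<And>x. x \<in> S \<Longrightarrow> f x = g x" "Ck_on k S f"
  shows "Ck_on k S g"
  using assms(2,3)
proof (induction k arbitrary: f g)
  case 0
  then show ?case
    by (simp cong: continuous_on_cong)
next
  case (Suc k)
  have "g differentiable at x" if "x \<in> S" for x
    using Suc.prems differentiable_cong_open[OF \<open>open S\<close> that, of f g] that by auto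
  moreover have "Ck_on k S (\<lambda>x. frechet_derivative g (at x) v)" for v
  proof (rule Suc.IH)
    show "frechet_derivative f (at x) v = frechet_derivative g (at x) v" if "x \<in> S" for x
      using Suc.prems(1) frechet_derivative_cong_open[OF \<open>open S\<close> that, of f g] by simp
    show "Ck_on k S (\<lambda>x. frechet_derivative f (at x) v)"
      using Suc.prems(2) by simp
  qed
  ultimately show ?case
    by simp
qed

text \<open>The derivative in the definition of \<^const>\<open>Ck_on\<close> is the total one, taken with \<^const>\<open>frechet_derivative\<close>;
this rule lets the closure properties below exhibit it by the rules of differentiation instead.\<close>

lemma Ck_on_SucI:
  assumes "open S" "\<And>x. x \<in> S \<Longrightarrow> (f has_derivative f' x) (at x)"
    "\<And>v. Ck_on k S (\<lambda>x. f' x v)"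
  shows "Ck_on (Suc k) S f"
proof -
  have "Ck_on k S (\<lambda>x. frechet_derivative f (at x) v)" for v
    by (rule Ck_on_cong[OF assms(1) _ assms(3)]) (simp add: frechet_derivative_eqI[OF assms(2)])
  then show ?thesis
    using assms(2) by (auto simp: differentiable_def)
qed

lemma Ck_on_SucD:
  assumes "Ck_on (Suc k) S f"
  shows "Ck_on k S f"
  using assms
proof (induction k arbitrary: f)
  case 0
  then show ?case
    by (auto intro!: continuous_at_imp_continuous_on differentiable_imp_continuous_within)
next
  case (Suc k)
  then show ?case
    by (metis Ck_on.simps(2))
qed

lemma Ck_on_has_derivative:
  assumes "Ck_on (Suc k) S f" "x \<in> S"
  shows "(f has_derivative frechet_derivative f (at x)) (at x)"
  using assms by (simp add: has_derivative_frechet)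

lemma Ck_on_const: "Ck_on k S (\<lambda>x. c)"
  by (induction k arbitrary: c) auto

lemma Ck_on_subset: "Ck_on k S f \<Longrightarrow> T \<subseteq> S \<Longrightarrow> Ck_on k T f"
  by (induction k arbitrary: f) (auto intro: continuous_on_subset)

lemma Ck_on_add:
  fixes f g :: "'a::real_normed_vector \<Rightarrow> 'b::real_normed_vector"
  assumes "open S" "Ck_on k S f" "Ck_on k S g"
  shows "Ck_on k S (\<lambda>x. f x + g x)"
  using assms(2,3)
proof (induction k arbitrary: f g)
  case 0
  then show ?case
    by (simp add: continuous_on_add)
next
  case (Suc k)
  show ?case
  proof (rule Ck_on_SucI[OF \<open>open S\<close>])
    show "((\<lambda>x. f x + g x) has_derivative
        (\<lambda>v. frechet_derivative f (at x) v + frechet_derivative g (at x) v)) (at x)"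
      if "x \<in> S" for x
      using Suc.prems that by (intro has_derivative_add Ck_on_has_derivative)
    show "Ck_on k S (\<lambda>x. frechet_derivative f (at x) v + frechet_derivative g (at x) v)" for v
      using Suc by simp
  qed
qed

lemma Ck_on_mult:
  fixes f g :: "'a::real_normed_vector \<Rightarrow> real"
  assumes "open S" "Ck_on k S f" "Ck_on k S g"
  shows "Ck_on k S (\<lambda>x. f x * g x)"
  using assms(2,3)
proof (induction k arbitrary: f g)
  case 0
  then show ?case
    by (simp add: continuous_on_mult)
next
  case (Suc k)
  show ?case
  proof (rule Ck_on_SucI[OF \<open>open S\<close>])
    show "((\<lambda>x. f x * g x) has_derivative
        (\<lambda>v. f x * frechet_derivative g (at x) v + frechet_derivative f (at x) v * g x)) (at x)"
      if "x \<in> S" for x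
      using Suc.prems that by (intro has_derivative_mult Ck_on_has_derivative)
    show "Ck_on k S (\<lambda>x. f x * frechet_derivative g (at x) v + frechet_derivative f (at x) v * g x)"
      for v
      using Suc.prems Ck_on_SucD[of k S f] Ck_on_SucD[of k S g]
      by (intro Ck_on_add[OF \<open>open S\<close>] Suc.IH) auto
  qed
qed

lemma Ck_on_inverse:
  fixes f :: "'a::real_normed_vector \<Rightarrow> real"
  assumes "open S" "Ck_on k S f" "\<And>x. x \<in> S \<Longrightarrow> f x \<noteq> 0"
  shows "Ck_on k S (\<lambda>x. inverse (f x))"
  using assms(2)
proof (induction k)
  case 0
  then show ?case
    using assms(3) by (auto intro: continuous_on_inverse)
next
  case (Suc k)
  show ?case
  proof (rule Ck_on_SucI[OF \<open>open S\<close>])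
    show "((\<lambda>x. inverse (f x)) has_derivative
        (\<lambda>v. (- 1) * (inverse (f x) * frechet_derivative f (at x) v * inverse (f x)))) (at x)"
      if "x \<in> S" for x
      using Deriv.has_derivative_inverse[OF assms(3)[OF that] Ck_on_has_derivative[OF Suc.prems that]]
      by simp
    have "Ck_on k S (\<lambda>x. inverse (f x))"
      using Suc Ck_on_SucD by blast
    then show "Ck_on k S
        (\<lambda>x. (- 1) * (inverse (f x) * frechet_derivative f (at x) v * inverse (f x)))" for v
      using Suc.prems by (intro Ck_on_mult[OF \<open>open S\<close>] Ck_on_const) auto
  qed
qed

lemma Ck_on_bounded_linear:
  assumes "open S" "bounded_linear L" "Ck_on k S f"
  shows "Ck_on k S (\<lambda>x. L (f x))"
  using assms(3)
proof (induction k arbitrary: f)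
  case 0
  then show ?case
    using assms(2) by (simp add: bounded_linear.continuous_on)
next
  case (Suc k)
  show ?case
  proof (rule Ck_on_SucI[OF \<open>open S\<close>])
    show "((\<lambda>x. L (f x)) has_derivative (\<lambda>v. L (frechet_derivative f (at x) v))) (at x)"
      if "x \<in> S" for x
      using Suc.prems that by (intro bounded_linear.has_derivative[OF assms(2)] Ck_on_has_derivative)
    show "Ck_on k S (\<lambda>x. L (frechet_derivative f (at x) v))" for v
      using Suc by simp
  qed
qed

lemma Ck_on_local:
  assumes "\<And>x. x \<in> S \<Longrightarrow> \<exists>T. open T \<and> x \<in> T \<and> Ck_on k T f"
  shows "Ck_on k S f"
  using assms
proof (induction k arbitrary: f)
  case 0
  have "isCont f x" if "x \<in> S" for x
    using 0[OF that] by (auto simp: continuous_on_eq_continuous_at)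
  then show ?case
    by (simp add: continuous_at_imp_continuous_on)
next
  case (Suc k)
  have "f differentiable at x" if "x \<in> S" for x
    using Suc.prems[OF that] by auto
  moreover have "Ck_on k S (\<lambda>x. frechet_derivative f (at x) v)" for v
  proof (rule Suc.IH)
    show "\<exists>T. open T \<and> x \<in> T \<and> Ck_on k T (\<lambda>x. frechet_derivative f (at x) v)" if "x \<in> S" for x
      using Suc.prems[OF that] by auto
  qed
  ultimately show ?case
    by simp
qed

lemma has_derivative_slice:
  assumes "(F has_derivative F') (at (t, x))"
  shows "((\<lambda>y. F (t, y)) has_derivative (\<lambda>v. F' (0, v))) (at x)"
  and "((\<lambda>s. F (s, x)) has_derivative (\<lambda>h. F' (h, 0))) (at t)"
proof -
  have "((\<lambda>y. (t, y)) has_derivative (\<lambda>v. (0, v))) (at x)"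
    by (auto intro!: derivative_eq_intros)
  from has_derivative_compose[OF this assms]
  show "((\<lambda>y. F (t, y)) has_derivative (\<lambda>v. F' (0, v))) (at x)"
    by simp
  have "((\<lambda>s. (s, x)) has_derivative (\<lambda>h. (h, 0))) (at t)"
    by (auto intro!: derivative_eq_intros)
  from has_derivative_compose[OF this assms]
  show "((\<lambda>s. F (s, x)) has_derivative (\<lambda>h. F' (h, 0))) (at t)"
    by simp
qed

lemma Ck_on_slice:
  assumes "open U" "t \<in> J" "Ck_on k (J \<times> U) F"
  shows "Ck_on k U (\<lambda>x. F (t, x))"
  using assms(3)
proof (induction k arbitrary: F)
  case 0
  have "continuous_on U (\<lambda>x. (t, x))"
    by (intro continuous_intros)
  with 0 assms(2) show ?case
    by (auto intro: continuous_on_compose2[of "J \<times> U" F U "\<lambda>x. (t, x)"])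
next
  case (Suc k)
  show ?case
  proof (rule Ck_on_SucI[OF \<open>open U\<close>])
    show "((\<lambda>x. F (t, x)) has_derivative (\<lambda>v. frechet_derivative F (at (t, x)) (0, v))) (at x)"
      if "x \<in> U" for x
      using that assms(2)
      by (intro has_derivative_slice(1) Ck_on_has_derivative[OF Suc.prems]) auto
    show "Ck_on k U (\<lambda>x. frechet_derivative F (at (t, x)) (0, v))" for v
      using Suc.prems by (intro Suc.IH) simp
  qed
qed

lemma smooth_on_has_derivative:
  "smooth_on S f \<Longrightarrow> x \<in> S \<Longrightarrow> (f has_derivative frechet_derivative f (at x)) (at x)"
  using Ck_on_has_derivative[of 0 S f x] by (simp add: smooth_on_def del: Ck_on.simps)

lemma smooth_on_differentiable: "smooth_on S f \<Longrightarrow> x \<in> S \<Longrightarrow> f differentiable at x"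
  using smooth_on_has_derivative[of S f x] by (auto simp: differentiable_def)

lemma smooth_on_derivative:
  "smooth_on S f \<Longrightarrow> smooth_on S (\<lambda>x. frechet_derivative f (at x) v)"
proof -
  assume "smooth_on S f"
  then have "Ck_on (Suc k) S f" for k
    by (simp add: smooth_on_def del: Ck_on.simps)
  then show ?thesis
    by (simp add: smooth_on_def)
qed

lemma smooth_on_const: "smooth_on S (\<lambda>x. c)"
  by (simp add: smooth_on_def Ck_on_const)

lemma smooth_on_subset: "smooth_on S f \<Longrightarrow> T \<subseteq> S \<Longrightarrow> smooth_on T f"
  unfolding smooth_on_def using Ck_on_subset[of _ S f T] by simp

lemma smooth_on_cong:
  "open S \<Longrightarrow> (\<And>x. x \<in> S \<Longrightarrow> f x = g x) \<Longrightarrow> smooth_on S f \<Longrightarrow> smooth_on S g"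
  unfolding smooth_on_def using Ck_on_cong[of S f g] by simp

lemma smooth_on_add:
  "open S \<Longrightarrow> smooth_on S f \<Longrightarrow> smooth_on S g \<Longrightarrow> smooth_on S (\<lambda>x. f x + g x)"
  unfolding smooth_on_def using Ck_on_add[of S _ f g] by simp

lemma smooth_on_mult:
  fixes f g :: "'a::real_normed_vector \<Rightarrow> real"
  shows "open S \<Longrightarrow> smooth_on S f \<Longrightarrow> smooth_on S g \<Longrightarrow> smooth_on S (\<lambda>x. f x * g x)"
  unfolding smooth_on_def using Ck_on_mult[of S _ f g] by simp

lemma smooth_on_sum:
  "open S \<Longrightarrow> (\<And>i. i \<in> I \<Longrightarrow> smooth_on S (f i)) \<Longrightarrow> smooth_on S (\<lambda>x. \<Sum>i\<in>I. f i x)"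
  by (induction I rule: infinite_finite_induct) (simp_all add: smooth_on_const smooth_on_add)

lemma smooth_on_divide:
  fixes f g :: "'a::real_normed_vector \<Rightarrow> real"
  assumes "open S" "smooth_on S f" "smooth_on S g" "\<And>x. x \<in> S \<Longrightarrow> g x \<noteq> 0"
  shows "smooth_on S (\<lambda>x. f x / g x)"
  unfolding divide_inverse using assms(2,3)
  by (auto simp: smooth_on_def intro!: Ck_on_mult Ck_on_inverse assms(1,4))

lemma smooth_on_bounded_linear:
  "open S \<Longrightarrow> bounded_linear L \<Longrightarrow> smooth_on S f \<Longrightarrow> smooth_on S (\<lambda>x. L (f x))"
  unfolding smooth_on_def using Ck_on_bounded_linear[of S L _ f] by simp

lemma smooth_on_local:
  assumes "\<And>x. x \<in> S \<Longrightarrow> \<exists>T. open T \<and> x \<in> T \<and> smooth_on T f"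
  shows "smooth_on S f"
  unfolding smooth_on_def
proof
  show "Ck_on k S f" for k
  proof (rule Ck_on_local)
    show "\<exists>T. open T \<and> x \<in> T \<and> Ck_on k T f" if "x \<in> S" for x
      using assms[OF that] by (auto simp: smooth_on_def)
  qed
qed

lemma smooth_on_slice:
  "open U \<Longrightarrow> t \<in> J \<Longrightarrow> smooth_on (J \<times> U) F \<Longrightarrow> smooth_on U (\<lambda>x. F (t, x))"
  unfolding smooth_on_def using Ck_on_slice[of U t J _ F] by simp

text \<open>The second difference of \<open>f\<close> over a parallelogram, divided by the area factor, is a mixed second derivative
at a point inside: apply the mean value theorem in the direction \<open>u\<close>, then in the direction \<open>v\<close>.
The left side is symmetric in \<open>u\<close> and \<open>v\<close>, which is what makes mixed derivatives commute.\<close>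

lemma second_difference_mean_value:
  fixes f :: "'a::real_normed_vector \<Rightarrow> real"
  assumes f: "\<And>y. y \<in> S \<Longrightarrow> f differentiable at y"
    and f': "\<And>y. y \<in> S \<Longrightarrow> (\<lambda>z. frechet_derivative f (at z) u) differentiable at y"
    and S: "\<And>a b. 0 \<le> a \<Longrightarrow> a \<le> h \<Longrightarrow> 0 \<le> b \<Longrightarrow> b \<le> h \<Longrightarrow> x + a *\<^sub>R u + b *\<^sub>R v \<in> S"
    and "0 < h"
  obtains a b where "0 < a" "a < h" "0 < b" "b < h"
    "f (x + h *\<^sub>R u + h *\<^sub>R v) - f (x + h *\<^sub>R u) - f (x + h *\<^sub>R v) + f x =
       h * h * frechet_derivative (\<lambda>z. frechet_derivative f (at z) u) (at (x + a *\<^sub>R u + b *\<^sub>R v)) v"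
proof -
  let ?D = "\<lambda>z. frechet_derivative f (at z)"
  let ?Du = "\<lambda>z. frechet_derivative f (at z) u"
  have line: "((\<lambda>s. f (x + s *\<^sub>R u + b *\<^sub>R v)) has_real_derivative ?Du (x + a *\<^sub>R u + b *\<^sub>R v)) (at a)"
    if "0 \<le> a" "a \<le> h" "0 \<le> b" "b \<le> h" for a b
  proof -
    have D: "(f has_derivative ?D (x + a *\<^sub>R u + b *\<^sub>R v)) (at (x + a *\<^sub>R u + b *\<^sub>R v))"
      using f S that by (simp add: has_derivative_frechet)
    have "((\<lambda>s. x + s *\<^sub>R u + b *\<^sub>R v) has_derivative (\<lambda>k. k *\<^sub>R u)) (at a)"
      by (auto intro!: derivative_eq_intros)
    from has_derivative_compose[OF this D]
    show ?thesis
      by (simp add: has_field_derivative_def linear_scale[OF has_derivative_linear[OF D]] mult.commute[of _ "?Du _"])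
  qed
  have "\<exists>a>0. a < h \<and>
      (\<lambda>s. f (x + s *\<^sub>R u + h *\<^sub>R v) - f (x + s *\<^sub>R u)) h - (\<lambda>s. f (x + s *\<^sub>R u + h *\<^sub>R v) - f (x + s *\<^sub>R u)) 0 =
      (h - 0) * (?Du (x + a *\<^sub>R u + h *\<^sub>R v) - ?Du (x + a *\<^sub>R u))"
    using line[of _ h] line[of _ 0] \<open>0 < h\<close> by (intro MVT2 DERIV_diff) auto
  then obtain a where a: "0 < a" "a < h" and
    eq1: "f (x + h *\<^sub>R u + h *\<^sub>R v) - f (x + h *\<^sub>R u) - f (x + h *\<^sub>R v) + f x =
      h * (?Du (x + a *\<^sub>R u + h *\<^sub>R v) - ?Du (x + a *\<^sub>R u))"
    by (auto simp: algebra_simps)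
  have "((\<lambda>s. ?Du (x + a *\<^sub>R u + s *\<^sub>R v)) has_real_derivative
      frechet_derivative ?Du (at (x + a *\<^sub>R u + b *\<^sub>R v)) v) (at b)"
    if "0 \<le> b" "b \<le> h" for b
  proof -
    have D: "(?Du has_derivative frechet_derivative ?Du (at (x + a *\<^sub>R u + b *\<^sub>R v)))
        (at (x + a *\<^sub>R u + b *\<^sub>R v))"
      using f' S a that by (simp add: has_derivative_frechet)
    have "((\<lambda>s. x + a *\<^sub>R u + s *\<^sub>R v) has_derivative (\<lambda>k. k *\<^sub>R v)) (at b)"
      by (auto intro!: derivative_eq_intros)
    from has_derivative_compose[OF this D]
    show ?thesis
      by (simp add: has_field_derivative_def linear_scale[OF has_derivative_linear[OF D]]
          mult.commute[of _ "frechet_derivative ?Du (at (x + a *\<^sub>R u + b *\<^sub>R v)) v"])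
  qed
  then have "\<exists>b>0. b < h \<and> ?Du (x + a *\<^sub>R u + h *\<^sub>R v) - ?Du (x + a *\<^sub>R u + 0 *\<^sub>R v) =
      (h - 0) * frechet_derivative ?Du (at (x + a *\<^sub>R u + b *\<^sub>R v)) v"
    using \<open>0 < h\<close> by (intro MVT2) auto
  then obtain b where "0 < b" "b < h" "?Du (x + a *\<^sub>R u + h *\<^sub>R v) - ?Du (x + a *\<^sub>R u) =
      h * frechet_derivative ?Du (at (x + a *\<^sub>R u + b *\<^sub>R v)) v"
    by auto
  with a eq1 show thesis
    by (intro that[of a b]) (simp_all only: mult.assoc)
qed

lemma mixed_derivatives_commute:
  fixes f :: "'a::real_normed_vector \<Rightarrow> real"
  assumes "open S" "x \<in> S" "smooth_on S f"
  shows "frechet_derivative (\<lambda>z. frechet_derivative f (at z) u) (at x) v =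
         frechet_derivative (\<lambda>z. frechet_derivative f (at z) v) (at x) u"
proof -
  let ?G = "\<lambda>u v z. frechet_derivative (\<lambda>z. frechet_derivative f (at z) u) (at z) v"
  have cont: "isCont (?G u v) x" for u v
    by (intro differentiable_imp_continuous_within smooth_on_differentiable[of S]
        smooth_on_derivative assms)
  have "\<bar>?G u v x - ?G v u x\<bar> \<le> 0 + e" if "0 < e" for e
  proof -
    have "\<forall>\<^sub>F y in nhds x. dist (?G u v y) (?G u v x) < e / 2" for u v
      using tendstoD[OF iffD1[OF tendsto_at_iff_tendsto_nhds cont[of u v, unfolded isCont_def]]]
        half_gt_zero[OF that] by blast
    then have "\<forall>\<^sub>F y in nhds x. y \<in> S \<and> dist (?G u v y) (?G u v x) < e / 2 \<and> dist (?G v u y) (?G v u x) < e / 2"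
      using assms(1,2) by (intro eventually_conj eventually_nhds_in_open)
    then obtain r where "0 < r" and
      r: "\<And>y. dist y x < r \<Longrightarrow> y \<in> S \<and> dist (?G u v y) (?G u v x) < e / 2 \<and> dist (?G v u y) (?G v u x) < e / 2"
      unfolding eventually_nhds_metric by auto
    \<comment> \<open>With this side length the whole parallelogram lies in the ball of radius \<open>r\<close> around \<open>x\<close>.\<close>
    define h where "h = r / (2 * (norm u + norm v + 1))"
    have pos: "norm u + norm v + 1 > 0"
      by (simp add: add_nonneg_pos)
    have "0 < h"
      unfolding h_def using \<open>0 < r\<close> pos by simp
    have small: "dist (x + a *\<^sub>R u + b *\<^sub>R v) x < r" if "0 \<le> a" "a \<le> h" "0 \<le> b" "b \<le> h" for a b
    proof -
      have "dist (x + a *\<^sub>R u + b *\<^sub>R v) x \<le> a * norm u + b * norm v"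
        using norm_triangle_ineq[of "a *\<^sub>R u" "b *\<^sub>R v"] that by (simp add: dist_norm add.assoc)
      also have "\<dots> \<le> h * norm u + h * norm v"
        using that by (intro add_mono mult_right_mono) auto
      also have "\<dots> \<le> h * (norm u + norm v + 1)"
        using \<open>0 < h\<close> by (simp add: algebra_simps)
      also have "\<dots> = r / 2"
        using pos unfolding h_def by (metis divide_divide_eq_left nonzero_eq_divide_eq less_irrefl)
      finally show ?thesis
        using \<open>0 < r\<close> by simp
    qed
    have diff: "f differentiable at y" "(\<lambda>z. frechet_derivative f (at z) w) differentiable at y"
      if "y \<in> S" for y w
      by (intro smooth_on_differentiable[OF _ that] smooth_on_derivative assms(3))+
    obtain a b where ab: "0 < a" "a < h" "0 < b" "b < h"
      "f (x + h *\<^sub>R u + h *\<^sub>R v) - f (x + h *\<^sub>R u) - f (x + h *\<^sub>R v) + f x =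
         h * h * ?G u v (x + a *\<^sub>R u + b *\<^sub>R v)"
      by (rule second_difference_mean_value[of S f u h x v]) (use diff r[OF small] \<open>0 < h\<close> in auto)
    obtain a' b' where ab': "0 < a'" "a' < h" "0 < b'" "b' < h"
      "f (x + h *\<^sub>R v + h *\<^sub>R u) - f (x + h *\<^sub>R v) - f (x + h *\<^sub>R u) + f x =
         h * h * ?G v u (x + a' *\<^sub>R v + b' *\<^sub>R u)"
    proof (rule second_difference_mean_value[of S f v h x u])
      show "x + a *\<^sub>R v + b *\<^sub>R u \<in> S" if "0 \<le> a" "a \<le> h" "0 \<le> b" "b \<le> h" for a b
        using r[OF small[OF that(3,4,1,2)]] by (simp only: add.assoc add.commute[of "a *\<^sub>R v"])
    qed (use diff \<open>0 < h\<close> in auto)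
    have swap: "f (x + h *\<^sub>R v + h *\<^sub>R u) - f (x + h *\<^sub>R v) - f (x + h *\<^sub>R u) + f x =
        f (x + h *\<^sub>R u + h *\<^sub>R v) - f (x + h *\<^sub>R u) - f (x + h *\<^sub>R v) + f x"
      "x + a' *\<^sub>R v + b' *\<^sub>R u = x + b' *\<^sub>R u + a' *\<^sub>R v"
      by (simp_all add: add.commute add.left_commute)
    have "h * h * ?G u v (x + a *\<^sub>R u + b *\<^sub>R v) = h * h * ?G v u (x + b' *\<^sub>R u + a' *\<^sub>R v)"
      using ab(5) ab'(5) unfolding swap by (simp only:)
    then have "?G u v (x + a *\<^sub>R u + b *\<^sub>R v) = ?G v u (x + b' *\<^sub>R u + a' *\<^sub>R v)"
      using \<open>0 < h\<close> by (simp only: mult_cancel_left) auto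
    moreover have "dist (?G u v (x + a *\<^sub>R u + b *\<^sub>R v)) (?G u v x) < e / 2"
      using r small ab by (simp add: less_imp_le)
    moreover have "dist (?G v u (x + b' *\<^sub>R u + a' *\<^sub>R v)) (?G v u x) < e / 2"
      using r small ab' by (simp add: less_imp_le)
    ultimately show ?thesis
      unfolding dist_real_def by linarith
  qed
  then show ?thesis
    using field_le_epsilon[of "\<bar>?G u v x - ?G v u x\<bar>" 0] by simp
qed

lemma deriv_slice:
  fixes F :: "real \<times> 'a::real_normed_vector \<Rightarrow> real"
  assumes "F differentiable at (t, x)"
  shows "deriv (\<lambda>s. F (s, x)) t = frechet_derivative F (at (t, x)) (1, 0)"
    and "((\<lambda>s. F (s, x)) has_real_derivative frechet_derivative F (at (t, x)) (1, 0)) (at t)"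
proof -
  have D: "(F has_derivative frechet_derivative F (at (t, x))) (at (t, x))"
    using assms by (rule has_derivative_frechet)
  have eq: "(\<lambda>h. frechet_derivative F (at (t, x)) (h, 0)) = (*) (frechet_derivative F (at (t, x)) (1, 0))"
  proof
    show "frechet_derivative F (at (t, x)) (h, 0) = frechet_derivative F (at (t, x)) (1, 0) * h" for h
      using linear_scale[OF has_derivative_linear[OF D], of h "(1, 0)"] by simp
  qed
  show D': "((\<lambda>s. F (s, x)) has_real_derivative frechet_derivative F (at (t, x)) (1, 0)) (at t)"
    unfolding has_field_derivative_def
    using iffD1[OF arg_cong[OF eq, of "\<lambda>D. ((\<lambda>s. F (s, x)) has_derivative D) (at t)"]]
      has_derivative_slice(2)[OF D] .
  then show "deriv (\<lambda>s. F (s, x)) t = frechet_derivative F (at (t, x)) (1, 0)"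
    by (rule DERIV_imp_deriv)
qed

lemma smooth_on_deriv_slice:
  fixes F :: "real \<times> 'a::real_normed_vector \<Rightarrow> real"
  assumes "open U" "t \<in> J" "smooth_on (J \<times> U) F"
  shows "smooth_on U (\<lambda>x. deriv (\<lambda>s. F (s, x)) t)"
proof (rule smooth_on_cong[OF \<open>open U\<close>])
  show "smooth_on U (\<lambda>x. frechet_derivative F (at (t, x)) (1, 0))"
    using smooth_on_slice[OF assms(1,2) smooth_on_derivative[OF assms(3)]] .
  show "frechet_derivative F (at (t, x)) (1, 0) = deriv (\<lambda>s. F (s, x)) t" if "x \<in> U" for x
    by (rule deriv_slice(1)[OF smooth_on_differentiable[OF assms(3)], symmetric])
      (use assms that in simp)
qed

text \<open>Both sides are mixed second derivatives of \<open>F\<close> on the product, in the directions \<open>(1, 0)\<close> and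
\<open>(0, v)\<close>. This is why the time derivative of a family of forms commutes with the exterior derivative.\<close>

lemma deriv_frechet_derivative_commute:
  fixes F :: "real \<times> 'a::real_normed_vector \<Rightarrow> real"
  assumes "open J" "open U" "t \<in> J" "x \<in> U" "smooth_on (J \<times> U) F"
  shows "((\<lambda>s. frechet_derivative (\<lambda>y. F (s, y)) (at x) v) has_real_derivative
      frechet_derivative (\<lambda>y. deriv (\<lambda>s. F (s, y)) t) (at x) v) (at t)"
proof -
  let ?Fv = "\<lambda>p. frechet_derivative F (at p) (0, v)"
  let ?Ft = "\<lambda>p. frechet_derivative F (at p) (1, 0)"
  have slice: "frechet_derivative (\<lambda>y. G (s, y)) (at y) v = frechet_derivative G (at (s, y)) (0, v)"
    if "smooth_on (J \<times> U) G" "s \<in> J" "y \<in> U" for G :: "real \<times> 'a \<Rightarrow> real" and s y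
    using that by (intro frechet_derivative_eqI[THEN fun_cong] has_derivative_slice(1)
        smooth_on_has_derivative[of "J \<times> U"]) auto
  have smooth: "smooth_on (J \<times> U) ?Fv" "smooth_on (J \<times> U) ?Ft"
    by (intro smooth_on_derivative assms(5))+
  have "((\<lambda>s. ?Fv (s, x)) has_real_derivative frechet_derivative ?Fv (at (t, x)) (1, 0)) (at t)"
    by (rule deriv_slice(2)[OF smooth_on_differentiable[OF smooth(1)]]) (use assms in simp)
  then have 1: "((\<lambda>s. frechet_derivative (\<lambda>y. F (s, y)) (at x) v) has_real_derivative
      frechet_derivative ?Fv (at (t, x)) (1, 0)) (at t)"
    by (rule has_field_derivative_transform_within_open[OF _ \<open>open J\<close> \<open>t \<in> J\<close>])
      (simp only: slice[OF assms(5) _ \<open>x \<in> U\<close>])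
  have "frechet_derivative (\<lambda>y. deriv (\<lambda>s. F (s, y)) t) (at x) =
      frechet_derivative (\<lambda>y. ?Ft (t, y)) (at x)"
  proof (rule frechet_derivative_cong_open[OF \<open>open U\<close> \<open>x \<in> U\<close>])
    show "deriv (\<lambda>s. F (s, y)) t = ?Ft (t, y)" if "y \<in> U" for y
      by (rule deriv_slice(1)[OF smooth_on_differentiable[OF assms(5)]]) (use assms that in simp)
  qed
  then have "frechet_derivative (\<lambda>y. deriv (\<lambda>s. F (s, y)) t) (at x) v =
      frechet_derivative ?Ft (at (t, x)) (0, v)"
    by (simp only: slice[OF smooth(2) \<open>t \<in> J\<close> \<open>x \<in> U\<close>])
  also have "\<dots> = frechet_derivative ?Fv (at (t, x)) (1, 0)"
    by (rule mixed_derivatives_commute[OF open_Times[OF assms(1,2)] _ assms(5)])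
      (use assms in simp)
  finally show ?thesis
    using 1 by simp
qed

section \<open>Alternating forms\<close>

text \<open>The tuple left after removing the entry at \<open>i\<close>: the argument of the \<open>i\<close>-th summand of the exterior derivative.\<close>

definition skip :: "nat \<Rightarrow> (nat \<Rightarrow> 'a) \<Rightarrow> nat \<Rightarrow> 'a" where
  "skip i v = (\<lambda>j. v (if j < i then j else Suc j))"

lemma alternating_form_cong:
  "alternating_form k a \<Longrightarrow> (\<And>i. i < k \<Longrightarrow> v i = w i) \<Longrightarrow> a v = a w"
  unfolding alternating_form_def by blast

lemma alternating_form_linear:
  "alternating_form k a \<Longrightarrow> i < k \<Longrightarrow> linear (\<lambda>u. a (v(i := u)))"
  unfolding alternating_form_def by blast

lemma alternating_form_repeat:
  "alternating_form k a \<Longrightarrow> i < j \<Longrightarrow> j < k \<Longrightarrow> v i = v j \<Longrightarrow> a v = 0"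
  unfolding alternating_form_def by blast

lemma alternating_form_zero: "alternating_form k (\<lambda>v. 0)"
  by (simp add: alternating_form_def linear_zero)

lemma alternating_form_add:
  assumes "alternating_form k a" "alternating_form k b"
  shows "alternating_form k (\<lambda>v. a v + b v)"
  unfolding alternating_form_def
proof (intro conjI allI impI)
  show "a v + b v = a w + b w" if "\<forall>i<k. v i = w i" for v w
    using alternating_form_cong[OF assms(1)] alternating_form_cong[OF assms(2)] that by metis
  show "linear (\<lambda>u. a (v(i := u)) + b (v(i := u)))" if "i < k" for i v
    using assms that by (intro linear_compose_add alternating_form_linear)
  show "a v + b v = 0" if "i < j \<and> j < k \<and> v i = v j" for v i j
    using alternating_form_repeat[OF assms(1), of i j v] alternating_form_repeat[OF assms(2), of i j v]
      that by simp
qed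

lemma alternating_form_cmult:
  assumes "alternating_form k a"
  shows "alternating_form k (\<lambda>v. r * a v)"
  unfolding alternating_form_def
proof (intro conjI allI impI)
  show "r * a v = r * a w" if "\<forall>i<k. v i = w i" for v w
    using alternating_form_cong[OF assms, of v w] that by simp
  show "linear (\<lambda>u. r * a (v(i := u)))" if "i < k" for i v
    using linear_compose_scale_right[OF alternating_form_linear[OF assms that]] by simp
  show "r * a v = 0" if "i < j \<and> j < k \<and> v i = v j" for v i j
    using alternating_form_repeat[OF assms, of i j v] that by simp
qed

text \<open>Vanishing on a tuple with equal entries at \<open>i\<close> and \<open>j\<close>: composing the summation index with the
transposition of \<open>i\<close> and \<open>j\<close> changes the sign of every summand but not the tuple, so the sum equals
its own negative.\<close>

lemma alternating_form_wedge:
  fixes a b :: "(nat \<Rightarrow> 'a::real_vector) \<Rightarrow> real"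
  assumes a: "alternating_form k a" and b: "alternating_form l b"
  shows "alternating_form (k + l) (\<lambda>v. \<Sum>\<sigma> | \<sigma> permutes {..<k + l}.
    of_int (sign \<sigma>) * a (\<lambda>i. v (\<sigma> i)) * b (\<lambda>i. v (\<sigma> (k + i))))"
  unfolding alternating_form_def
proof (intro conjI allI impI)
  let ?P = "{\<sigma>. \<sigma> permutes {..<k + l}}"
  have fin: "finite ?P"
    by (simp add: finite_permutations)
  fix v w :: "nat \<Rightarrow> 'a"
  assume vw: "\<forall>i<k + l. v i = w i"
  show "(\<Sum>\<sigma>\<in>?P. of_int (sign \<sigma>) * a (\<lambda>i. v (\<sigma> i)) * b (\<lambda>i. v (\<sigma> (k + i)))) =
      (\<Sum>\<sigma>\<in>?P. of_int (sign \<sigma>) * a (\<lambda>i. w (\<sigma> i)) * b (\<lambda>i. w (\<sigma> (k + i))))"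
  proof (intro sum.cong refl)
    fix \<sigma> assume "\<sigma> \<in> ?P"
    then have "\<sigma> i < k + l" if "i < k + l" for i
      using permutes_in_image[of \<sigma> "{..<k + l}" i] that by auto
    then have "a (\<lambda>i. v (\<sigma> i)) = a (\<lambda>i. w (\<sigma> i))" "b (\<lambda>i. v (\<sigma> (k + i))) = b (\<lambda>i. w (\<sigma> (k + i)))"
      using vw by (auto intro!: alternating_form_cong[OF a] alternating_form_cong[OF b])
    then show "of_int (sign \<sigma>) * a (\<lambda>i. v (\<sigma> i)) * b (\<lambda>i. v (\<sigma> (k + i))) =
        of_int (sign \<sigma>) * a (\<lambda>i. w (\<sigma> i)) * b (\<lambda>i. w (\<sigma> (k + i)))"
      by simp
  qed
next
  let ?P = "{\<sigma>. \<sigma> permutes {..<k + l}}"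
  fix i and v :: "nat \<Rightarrow> 'a"
  assume i: "i < k + l"
  show "linear (\<lambda>u. \<Sum>\<sigma>\<in>?P. of_int (sign \<sigma>) *
      a (\<lambda>j. (v(i := u)) (\<sigma> j)) * b (\<lambda>j. (v(i := u)) (\<sigma> (k + j))))"
  proof (intro linear_compose_sum ballI)
    fix \<sigma> assume "\<sigma> \<in> ?P"
    then have \<sigma>: "\<sigma> permutes {..<k + l}"
      by simp
    \<comment> \<open>The varied entry is read by the first factor if \<open>m < k\<close> and by the second one otherwise.\<close>
    define m where "m = inv \<sigma> i"
    have m: "\<sigma> m = i" "m < k + l"
      using permutes_inverses[OF \<sigma>] permutes_in_image[OF permutes_inv[OF \<sigma>], of i] i
      by (auto simp: m_def)
    have \<sigma>_eq: "\<sigma> j = i \<longleftrightarrow> j = m" for j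
      using permutes_inj[OF \<sigma>] m by (metis injD)
    show "linear (\<lambda>u. of_int (sign \<sigma>) *
      a (\<lambda>j. (v(i := u)) (\<sigma> j)) * b (\<lambda>j. (v(i := u)) (\<sigma> (k + j))))"
    proof (cases "m < k")
      case True
      have "a (\<lambda>j. (v(i := u)) (\<sigma> j)) = a ((\<lambda>j. v (\<sigma> j))(m := u))" for u
        by (rule arg_cong[of _ _ a]) (auto simp: \<sigma>_eq)
      moreover have "b (\<lambda>j. (v(i := u)) (\<sigma> (k + j))) = b (\<lambda>j. v (\<sigma> (k + j)))" for u
        using True by (intro arg_cong[of _ _ b]) (auto simp: \<sigma>_eq)
      moreover have "linear (\<lambda>u. (of_int (sign \<sigma>) * b (\<lambda>j. v (\<sigma> (k + j)))) *\<^sub>R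
          a ((\<lambda>j. v (\<sigma> j))(m := u)))"
        by (intro linear_compose_scale_right alternating_form_linear[OF a True])
      ultimately show ?thesis
        by (simp add: mult_ac)
    next
      case False
      have "b (\<lambda>j. (v(i := u)) (\<sigma> (k + j))) = b ((\<lambda>j. v (\<sigma> (k + j)))(m - k := u))" for u
        using False by (intro arg_cong[of _ _ b]) (auto simp: \<sigma>_eq fun_eq_iff)
      moreover have "a (\<lambda>j. (v(i := u)) (\<sigma> j)) = a (\<lambda>j. v (\<sigma> j))" for u
        using False by (intro alternating_form_cong[OF a]) (auto simp: \<sigma>_eq)
      moreover have "linear (\<lambda>u. (of_int (sign \<sigma>) * a (\<lambda>j. v (\<sigma> j))) *\<^sub>R
          b ((\<lambda>j. v (\<sigma> (k + j)))(m - k := u)))"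
        using False m by (intro linear_compose_scale_right alternating_form_linear[OF b]) auto
      ultimately show ?thesis
        by (simp add: mult_ac)
    qed
  qed
next
  let ?P = "{\<sigma>. \<sigma> permutes {..<k + l}}"
  let ?t = "\<lambda>v \<sigma>. of_int (sign \<sigma>) * a (\<lambda>i. v (\<sigma> i)) * b (\<lambda>i. v (\<sigma> (k + i)))"
  fix v :: "nat \<Rightarrow> 'a" and i j
  assume ij: "i < j \<and> j < k + l \<and> v i = v j"
  let ?\<tau> = "Transposition.transpose i j"
  have \<tau>: "?\<tau> permutes {..<k + l}"
    using ij by (intro permutes_swap_id) auto
  have v: "v (?\<tau> n) = v n" for n
    using ij by (auto simp: Transposition.transpose_def)
  have "(\<Sum>\<sigma>\<in>?P. ?t v \<sigma>) = (\<Sum>\<sigma>\<in>?P. ?t v (?\<tau> \<circ> \<sigma>))"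
    by (rule setum_permutations_compose_left[OF \<tau>])
  also have "\<dots> = (\<Sum>\<sigma>\<in>?P. - ?t v \<sigma>)"
  proof (intro sum.cong refl)
    fix \<sigma> assume "\<sigma> \<in> ?P"
    then have "permutation \<sigma>"
      by (auto intro: permutation_permutes[THEN iffD2])
    then have "sign (?\<tau> \<circ> \<sigma>) = - sign \<sigma>"
      using ij by (simp add: sign_compose permutation_swap_id sign_swap_id)
    then show "?t v (?\<tau> \<circ> \<sigma>) = - ?t v \<sigma>"
      by (simp add: v)
  qed
  also have "\<dots> = - (\<Sum>\<sigma>\<in>?P. ?t v \<sigma>)"
    by (rule sum_negf)
  finally show "(\<Sum>\<sigma>\<in>?P. ?t v \<sigma>) = 0"
    by simp
qed

text \<open>The products of low degree are used through these explicit formulas, which turn identities between forms into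
identities between real polynomials in the values of the forms.\<close>

lemma wedge_1_1:
  assumes "alternating_form 1 (\<alpha> c x)" "alternating_form 1 (\<beta> c x)"
  shows "wedge 1 1 \<alpha> \<beta> c x v =
    \<alpha> c x (\<lambda>_. v 0) * \<beta> c x (\<lambda>_. v 1) - \<alpha> c x (\<lambda>_. v 1) * \<beta> c x (\<lambda>_. v 0)"
proof -
  have \<beta>: "\<beta> c x w = \<beta> c x w'" if "w 0 = w' 0" for w w'
    using that by (intro alternating_form_cong[OF assms(2)]) simp
  have \<alpha>: "\<alpha> c x w = \<alpha> c x w'" if "w 0 = w' 0" for w w'
    using that by (intro alternating_form_cong[OF assms(1)]) simp
  have "{..<1 + 1} = insert 0 {1::nat}"
    by auto
  then have "wedge 1 1 \<alpha> \<beta> c x v =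
      \<alpha> c x (\<lambda>i. v i) * \<beta> c x (\<lambda>i. v (1 + i)) -
      \<alpha> c x (\<lambda>i. v (Transposition.transpose 0 1 i)) * \<beta> c x (\<lambda>i. v (Transposition.transpose 0 1 (1 + i)))"
    by (simp add: wedge_def sum_over_permutations_insert permutes_sing sign_swap_id sign_id)
  also have "\<dots> = \<alpha> c x (\<lambda>_. v 0) * \<beta> c x (\<lambda>_. v 1) - \<alpha> c x (\<lambda>_. v 1) * \<beta> c x (\<lambda>_. v 0)"
    by (intro arg_cong2[of _ _ _ _ "(-)"] arg_cong2[of _ _ _ _ "(*)"] \<alpha> \<beta>) simp_all
  finally show ?thesis .
qed

lemma wedge_1_2:
  assumes "alternating_form 1 (\<alpha> c x)" "alternating_form 2 (\<tau> c x)"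
  shows "wedge 1 2 \<alpha> \<tau> c x v =
    \<alpha> c x (\<lambda>_. v 0) * \<tau> c x (skip 0 v) - \<alpha> c x (\<lambda>_. v 1) * \<tau> c x (skip 1 v)
      + \<alpha> c x (\<lambda>_. v 2) * \<tau> c x (skip 2 v)"
proof -
  have \<alpha>: "\<alpha> c x w = \<alpha> c x (\<lambda>_. w 0)" for w
    by (intro alternating_form_cong[OF assms(1)]) simp
  define T where "T p q = \<tau> c x (\<lambda>i. if i = 0 then p else q)" for p q
  have \<tau>: "\<tau> c x w = T (w 0) (w 1)" for w
    unfolding T_def by (intro alternating_form_cong[OF assms(2)]) (auto simp: less_2_cases_iff)
  have "linear (\<lambda>u. T u q)" "linear (\<lambda>u. T p u)" for p q
    using alternating_form_linear[OF assms(2), where i = 0 and v = "\<lambda>_. q"]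
      alternating_form_linear[OF assms(2), where i = 1 and v = "\<lambda>_. p"] by (simp_all add: \<tau>)
  then have add: "T (p + p') q = T p q + T p' q" "T p (q + q') = T p q + T p q'" for p p' q q'
    using linear_add by metis+
  have zero: "T p p = 0" for p
    using alternating_form_repeat[OF assms(2), where i = 0 and j = 1 and v = "\<lambda>_. p"] by (simp add: \<tau>)
  have anti: "T q p = - T p q" for p q
    using zero[of "p + q"] zero[of p] zero[of q] unfolding add by linarith
  obtain p q r where v: "v 0 = p" "v (Suc 0) = q" "v 2 = r" "v (Suc (Suc 0)) = r"
    by (metis numeral_2_eq_2)
  have "{..<1 + 2} = insert 0 (insert 1 {2::nat})"
    by auto
  then show ?thesis
    unfolding wedge_def \<tau>
    by (subst \<alpha>) (simp add: sum_over_permutations_insert permutes_sing sign_swap_id sign_id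
      sign_compose permutation_swap_id Transposition.transpose_def skip_def v
      anti[of p q] anti[of p r] anti[of q r])
qed

section \<open>Calculus of differential forms\<close>

text \<open>As forms are zero off their domains, the algebraic properties of a form hold at every point, in every chart.\<close>

lemma is_form_alternating:
  assumes "is_form A k \<omega>"
  shows "alternating_form k (\<omega> c x)"
proof (cases "c \<in> A \<and> x \<in> ctarget c")
  case True
  with assms show ?thesis
    by (auto simp: is_form_def)
next
  case False
  with assms have "\<omega> c x = (\<lambda>v. 0)"
    unfolding is_form_def by blast
  then show ?thesis
    by (simp add: alternating_form_zero)
qed

lemma is_form_smooth: "is_form A k \<omega> \<Longrightarrow> c \<in> A \<Longrightarrow> smooth_on (ctarget c) (\<lambda>x. \<omega> c x v)"
  by (simp add: is_form_def)

lemma is_form_has_derivative: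
  "is_form A k \<omega> \<Longrightarrow> c \<in> A \<Longrightarrow> x \<in> ctarget c \<Longrightarrow>
    ((\<lambda>y. \<omega> c y v) has_derivative frechet_derivative (\<lambda>y. \<omega> c y v) (at x)) (at x)"
  using smooth_on_has_derivative[OF is_form_smooth] .

lemma is_form_pullback:
  assumes "is_form A k \<omega>" "c \<in> A" "c' \<in> A" "x \<in> coord c ` (cdom c \<inter> cdom c')"
  shows "\<omega> c x v = \<omega> c' (coord c' (param c x))
    (\<lambda>i. frechet_derivative (coord c' \<circ> param c) (at x) (v i))"
  using assms unfolding is_form_def by blast

lemma is_form_off: "is_form A k \<omega> \<Longrightarrow> c \<notin> A \<or> x \<notin> ctarget c \<Longrightarrow> \<omega> c x v = 0"
  unfolding is_form_def by blast

lemma is_form_cong: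
  "is_form A k \<omega> \<Longrightarrow> (\<And>i. i < k \<Longrightarrow> v i = w i) \<Longrightarrow> \<omega> c x v = \<omega> c x w"
  using alternating_form_cong[OF is_form_alternating] .

lemma is_form_0: "is_form A 0 g \<Longrightarrow> g c x v = g c x w"
  by (rule is_form_cong) auto

lemma is_form_1: "is_form A 1 \<alpha> \<Longrightarrow> \<alpha> c x v = \<alpha> c x (\<lambda>_. v 0)"
  by (rule is_form_cong) auto

lemma linear_is_form_1:
  assumes "is_form A 1 \<alpha>"
  shows "linear (\<lambda>u. \<alpha> c x (\<lambda>_. u))"
proof -
  have "linear (\<lambda>u. \<alpha> c x ((\<lambda>_. 0)(0 := u)))"
    using alternating_form_linear[OF is_form_alternating[OF assms]] by simp
  then show ?thesis
    using is_form_1[OF assms, of c x "(\<lambda>_. 0)(0 := _)"] by simp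
qed

lemma form_eqI:
  assumes "is_form A k \<omega>" "is_form A l \<eta>"
    "\<And>c x v. c \<in> A \<Longrightarrow> x \<in> ctarget c \<Longrightarrow> \<omega> c x v = \<eta> c x v"
  shows "\<omega> = \<eta>"
proof (intro ext)
  show "\<omega> c x v = \<eta> c x v" for c x v
    using assms(3)[of c x v] is_form_off[OF assms(1), of c x v] is_form_off[OF assms(2), of c x v]
    by metis
qed

lemma wedge_1_1_form:
  assumes "is_form A 1 \<alpha>" "is_form A 1 \<beta>"
  shows "wedge 1 1 \<alpha> \<beta> c x v =
    \<alpha> c x (\<lambda>_. v 0) * \<beta> c x (\<lambda>_. v 1) - \<alpha> c x (\<lambda>_. v 1) * \<beta> c x (\<lambda>_. v 0)"
  by (intro wedge_1_1 is_form_alternating[OF assms(1)] is_form_alternating[OF assms(2)])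

lemma wedge_1_2_form:
  assumes "is_form A 1 \<alpha>" "is_form A 2 \<tau>"
  shows "wedge 1 2 \<alpha> \<tau> c x v =
    \<alpha> c x (\<lambda>_. v 0) * \<tau> c x (skip 0 v) - \<alpha> c x (\<lambda>_. v 1) * \<tau> c x (skip 1 v)
      + \<alpha> c x (\<lambda>_. v 2) * \<tau> c x (skip 2 v)"
  by (intro wedge_1_2 is_form_alternating[OF assms(1)] is_form_alternating[OF assms(2)])

lemma ext_d_apply:
  "c \<in> A \<Longrightarrow> x \<in> ctarget c \<Longrightarrow> ext_d A k \<omega> c x v =
    (\<Sum>i\<le>k. (-1) ^ i * frechet_derivative (\<lambda>y. \<omega> c y (skip i v)) (at x) (v i))"
  by (simp add: ext_d_def skip_def)

lemma ext_d_off: "c \<notin> A \<or> x \<notin> ctarget c \<Longrightarrow> ext_d A k \<omega> c x v = 0"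
  by (auto simp: ext_d_def)

locale manifold =
  fixes A :: "('m::{t2_space,second_countable_topology}, 'e::euclidean_space) chart set"
  assumes smooth_atlas: "smooth_atlas A"
begin

lemma open_ctarget: "c \<in> A \<Longrightarrow> open (ctarget c)"
  using smooth_atlas by (simp add: smooth_atlas_def is_chart_def)

lemma coord_param: "c \<in> A \<Longrightarrow> x \<in> ctarget c \<Longrightarrow> coord c (param c x) = x"
  using smooth_atlas by (auto simp: smooth_atlas_def is_chart_def homeomorphism_def)

lemma param_coord: "c \<in> A \<Longrightarrow> p \<in> cdom c \<Longrightarrow> param c (coord c p) = p"
  using smooth_atlas by (auto simp: smooth_atlas_def is_chart_def homeomorphism_def)

lemma param_in_cdom: "c \<in> A \<Longrightarrow> x \<in> ctarget c \<Longrightarrow> param c x \<in> cdom c"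
  using smooth_atlas by (auto simp: smooth_atlas_def is_chart_def homeomorphism_def)

lemma open_overlap:
  assumes "c \<in> A" "c' \<in> A"
  shows "open (coord c ` (cdom c \<inter> cdom c'))"
proof -
  have "homeomorphism (cdom c) (ctarget c) (coord c) (param c)" "open (cdom c')" "open (ctarget c)"
    using smooth_atlas assms by (auto simp: smooth_atlas_def is_chart_def)
  then have "open (param c -` cdom c' \<inter> ctarget c)"
    using continuous_on_open_vimage[of "ctarget c" "param c"] by (simp add: homeomorphism_def)
  moreover have "coord c ` (cdom c \<inter> cdom c') = param c -` cdom c' \<inter> ctarget c"
    using assms(1) by (force simp: param_coord coord_param param_in_cdom ctarget_def
        intro: rev_image_eqI)
  ultimately show ?thesis
    by simp
qed

lemma overlap_subset: "coord c ` (cdom c \<inter> cdom c') \<subseteq> ctarget c"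
  by (auto simp: ctarget_def)

lemma transition_in_ctarget:
  "c \<in> A \<Longrightarrow> x \<in> coord c ` (cdom c \<inter> cdom c') \<Longrightarrow> coord c' (param c x) \<in> ctarget c'"
  by (auto simp: param_coord ctarget_def)

lemma smooth_transition:
  "c \<in> A \<Longrightarrow> c' \<in> A \<Longrightarrow> smooth_on (coord c ` (cdom c \<inter> cdom c')) (coord c' \<circ> param c)"
  using smooth_atlas by (simp add: smooth_atlas_def)

lemma is_form_add:
  assumes "is_form A k \<omega>" "is_form A k \<eta>"
  shows "is_form A k (\<lambda>c x v. \<omega> c x v + \<eta> c x v)"
  unfolding is_form_def
proof (intro conjI ballI allI impI)
  show "alternating_form k (\<lambda>v. \<omega> c x v + \<eta> c x v)" for c x
    by (intro alternating_form_add is_form_alternating[OF assms(1)] is_form_alternating[OF assms(2)])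
  show "smooth_on (ctarget c) (\<lambda>x. \<omega> c x v + \<eta> c x v)" if "c \<in> A" for c v
    using assms that by (intro smooth_on_add open_ctarget is_form_smooth)
qed (metis is_form_pullback[OF assms(1)] is_form_pullback[OF assms(2)],
     simp add: is_form_off[OF assms(1)] is_form_off[OF assms(2)])

lemma is_form_scale:
  assumes "is_form A 0 g" "is_form A k \<omega>"
  shows "is_form A k (\<lambda>c x v. g c x v * \<omega> c x v)"
  unfolding is_form_def
proof (intro conjI ballI allI impI)
  show "alternating_form k (\<lambda>v. g c x v * \<omega> c x v)" for c x
  proof -
    have "(\<lambda>v. g c x v * \<omega> c x v) = (\<lambda>v. g c x undefined * \<omega> c x v)"
      using is_form_0[OF assms(1)] by metis
    then show ?thesis
      using alternating_form_cmult[OF is_form_alternating[OF assms(2)]] by simp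
  qed
  show "smooth_on (ctarget c) (\<lambda>x. g c x v * \<omega> c x v)" if "c \<in> A" for c v
    using assms that by (intro smooth_on_mult open_ctarget is_form_smooth)
qed (metis is_form_pullback[OF assms(1)] is_form_pullback[OF assms(2)],
     simp add: is_form_off[OF assms(1)])

lemma is_form_cmult:
  assumes "is_form A k \<omega>"
  shows "is_form A k (\<lambda>c x v. r * \<omega> c x v)"
  unfolding is_form_def
proof (intro conjI ballI allI impI)
  show "alternating_form k (\<lambda>v. r * \<omega> c x v)" for c x
    by (intro alternating_form_cmult is_form_alternating[OF assms(1)])
  show "smooth_on (ctarget c) (\<lambda>x. r * \<omega> c x v)" if "c \<in> A" for c v
    using assms that by (intro smooth_on_mult smooth_on_const open_ctarget is_form_smooth)
qed (metis is_form_pullback[OF assms(1)], simp add: is_form_off[OF assms(1)])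

lemma is_form_diff:
  assumes "is_form A k \<omega>" "is_form A k \<eta>"
  shows "is_form A k (\<lambda>c x v. \<omega> c x v - \<eta> c x v)"
  using is_form_add[OF assms(1) is_form_cmult[OF assms(2), of "-1"]] by simp

lemma is_form_wedge:
  assumes "is_form A k \<omega>" "is_form A l \<eta>"
  shows "is_form A (k + l) (wedge k l \<omega> \<eta>)"
  unfolding is_form_def
proof (intro conjI ballI allI impI)
  show "alternating_form (k + l) (wedge k l \<omega> \<eta> c x)" for c x
    using alternating_form_cmult[OF alternating_form_wedge[OF is_form_alternating[OF assms(1)]
      is_form_alternating[OF assms(2)]], of "1 / (fact k * fact l)" c x c x]
    by (simp add: wedge_def)
  show "smooth_on (ctarget c) (\<lambda>x. wedge k l \<omega> \<eta> c x v)" if "c \<in> A" for c v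
    unfolding wedge_def divide_inverse
    by (intro smooth_on_mult smooth_on_sum smooth_on_const open_ctarget is_form_smooth[OF assms(1)]
        is_form_smooth[OF assms(2)] that)
  show "wedge k l \<omega> \<eta> c x v = wedge k l \<omega> \<eta> c' (coord c' (param c x))
      (\<lambda>i. frechet_derivative (coord c' \<circ> param c) (at x) (v i))"
    if "c \<in> A" "c' \<in> A" "x \<in> coord c ` (cdom c \<inter> cdom c')" for c c' x v
    unfolding wedge_def
    by (subst is_form_pullback[OF assms(1) that], subst is_form_pullback[OF assms(2) that]) simp
  show "wedge k l \<omega> \<eta> c x v = 0" if "c \<notin> A \<or> x \<notin> ctarget c" for c x v
    by (simp add: wedge_def is_form_off[OF assms(1) that])
qed

lemma is_form_wedge_1_1:
  assumes "is_form A 1 \<alpha>" "is_form A 1 \<beta>"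
  shows "is_form A 2 (wedge 1 1 \<alpha> \<beta>)"
  using is_form_wedge[OF assms] unfolding one_add_one .

lemma ext_d_0:
  assumes "is_form A 0 g" "c \<in> A" "x \<in> ctarget c"
  shows "ext_d A 0 g c x v = frechet_derivative (\<lambda>y. g c y w) (at x) (v 0)"
  using assms(2,3) is_form_0[OF assms(1), of c _ "skip 0 v" w] by (simp add: ext_d_apply)

lemma ext_d_1:
  assumes "is_form A 1 \<alpha>" "c \<in> A" "x \<in> ctarget c"
  shows "ext_d A 1 \<alpha> c x v = frechet_derivative (\<lambda>y. \<alpha> c y (\<lambda>_. v 1)) (at x) (v 0)
    - frechet_derivative (\<lambda>y. \<alpha> c y (\<lambda>_. v 0)) (at x) (v 1)"
  using assms(2,3) is_form_1[OF assms(1), of c _ "skip 0 v"] is_form_1[OF assms(1), of c _ "skip 1 v"]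
  by (simp add: ext_d_apply skip_def)

lemma ext_d_add:
  assumes "is_form A k \<omega>" "is_form A k \<eta>"
  shows "ext_d A k (\<lambda>c x v. \<omega> c x v + \<eta> c x v) = (\<lambda>c x v. ext_d A k \<omega> c x v + ext_d A k \<eta> c x v)"
proof (intro ext)
  fix c x v
  show "ext_d A k (\<lambda>c x v. \<omega> c x v + \<eta> c x v) c x v = ext_d A k \<omega> c x v + ext_d A k \<eta> c x v"
  proof (cases "c \<in> A \<and> x \<in> ctarget c")
    case True
    then have "frechet_derivative (\<lambda>y. \<omega> c y w + \<eta> c y w) (at x) u =
        frechet_derivative (\<lambda>y. \<omega> c y w) (at x) u + frechet_derivative (\<lambda>y. \<eta> c y w) (at x) u" for w u
      by (intro frechet_derivative_eqI[THEN fun_cong] has_derivative_add is_form_has_derivative[OF assms(1)]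
        is_form_has_derivative[OF assms(2)]) auto
    with True show ?thesis
      by (simp add: ext_d_apply sum.distrib algebra_simps)
  qed (auto simp: ext_d_off)
qed

lemma ext_d_cmult:
  assumes "is_form A k \<omega>"
  shows "ext_d A k (\<lambda>c x v. r * \<omega> c x v) = (\<lambda>c x v. r * ext_d A k \<omega> c x v)"
proof (intro ext)
  fix c x v
  show "ext_d A k (\<lambda>c x v. r * \<omega> c x v) c x v = r * ext_d A k \<omega> c x v"
  proof (cases "c \<in> A \<and> x \<in> ctarget c")
    case True
    then have "frechet_derivative (\<lambda>y. r * \<omega> c y w) (at x) u =
        r * frechet_derivative (\<lambda>y. \<omega> c y w) (at x) u" for w u
      by (intro frechet_derivative_eqI[THEN fun_cong] has_derivative_mult_right is_form_has_derivative[OF assms]) auto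
    with True show ?thesis
      by (simp add: ext_d_apply sum_distrib_left mult_ac)
  qed (auto simp: ext_d_off)
qed

lemma ext_d_diff:
  assumes "is_form A k \<omega>" "is_form A k \<eta>"
  shows "ext_d A k (\<lambda>c x v. \<omega> c x v - \<eta> c x v) = (\<lambda>c x v. ext_d A k \<omega> c x v - ext_d A k \<eta> c x v)"
  using ext_d_add[OF assms(1) is_form_cmult[OF assms(2), of "-1"]] ext_d_cmult[OF assms(2), of "-1"]
  by simp

lemma ext_d_scale:
  assumes "is_form A 0 g" "is_form A 1 \<alpha>"
  shows "ext_d A 1 (\<lambda>c x v. g c x v * \<alpha> c x v) c x v =
    ext_d A 0 g c x (\<lambda>_. v 0) * \<alpha> c x (\<lambda>_. v 1) - ext_d A 0 g c x (\<lambda>_. v 1) * \<alpha> c x (\<lambda>_. v 0)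
      + g c x v * ext_d A 1 \<alpha> c x v"
proof (cases "c \<in> A \<and> x \<in> ctarget c")
  case True
  then have cx: "c \<in> A" "x \<in> ctarget c"
    by auto
  have "frechet_derivative (\<lambda>y. g c y w' * \<alpha> c y w) (at x) u =
      g c x v * frechet_derivative (\<lambda>y. \<alpha> c y w) (at x) u
      + frechet_derivative (\<lambda>y. g c y v) (at x) u * \<alpha> c x w" for w w' u
  proof -
    have "(\<lambda>y. g c y w' * \<alpha> c y w) = (\<lambda>y. g c y v * \<alpha> c y w)"
      using is_form_0[OF assms(1)] by metis
    then show ?thesis
      by (simp only:) (intro frechet_derivative_eqI[THEN fun_cong] has_derivative_mult
        is_form_has_derivative[OF assms(1) cx] is_form_has_derivative[OF assms(2) cx])
  qed
  then show ?thesis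
    unfolding ext_d_1[OF is_form_scale[OF assms] cx] ext_d_1[OF assms(2) cx] ext_d_0[OF assms(1) cx, of _ v]
    by (simp add: algebra_simps)
next
  case False
  then show ?thesis
    by (simp add: ext_d_off)
qed

lemma is_form_ext_d_0:
  assumes "is_form A 0 g"
  shows "is_form A 1 (ext_d A 0 g)"
  unfolding is_form_def
proof (intro conjI ballI allI impI)
  fix c assume c: "c \<in> A"
  show "alternating_form 1 (ext_d A 0 g c x)" if "x \<in> ctarget c" for x
  proof -
    have "linear (frechet_derivative (\<lambda>y. g c y undefined) (at x))"
      using is_form_has_derivative[OF assms c that] by (rule has_derivative_linear)
    then show ?thesis
      by (auto simp: alternating_form_def ext_d_0[OF assms c that, of _ undefined])
  qed
  have "smooth_on (ctarget c) (\<lambda>x. frechet_derivative (\<lambda>y. g c y undefined) (at x) (v 0))" for v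
    by (intro smooth_on_derivative is_form_smooth[OF assms c])
  then show "smooth_on (ctarget c) (\<lambda>x. ext_d A 0 g c x v)" for v
    by (rule smooth_on_cong[OF open_ctarget[OF c], rotated]) (simp add: ext_d_0[OF assms c, of _ _ undefined])
  fix c' x and v :: "nat \<Rightarrow> 'e"
  assume c': "c' \<in> A" and x: "x \<in> coord c ` (cdom c \<inter> cdom c')"
  let ?\<phi> = "coord c' \<circ> param c"
  have x': "x \<in> ctarget c" "?\<phi> x \<in> ctarget c'"
    using x overlap_subset[of c c'] transition_in_ctarget[OF c x] by (blast, simp)
  have "frechet_derivative (\<lambda>y. g c y undefined) (at x) =
      frechet_derivative (\<lambda>y. g c' (?\<phi> y) undefined) (at x)"
  proof (rule frechet_derivative_cong_open[OF open_overlap[OF c c'] x])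
    show "g c y undefined = g c' (?\<phi> y) undefined" if "y \<in> coord c ` (cdom c \<inter> cdom c')" for y
      unfolding is_form_pullback[OF assms c c' that] comp_def by (rule is_form_0[OF assms])
  qed
  also have "\<dots> = (\<lambda>u. frechet_derivative (\<lambda>z. g c' z undefined) (at (?\<phi> x)) (frechet_derivative ?\<phi> (at x) u))"
    by (rule frechet_derivative_eqI[OF has_derivative_compose
        [OF smooth_on_has_derivative[OF smooth_transition[OF c c'] x] is_form_has_derivative[OF assms c' x'(2)]]])
  finally have "frechet_derivative (\<lambda>y. g c y undefined) (at x) (v 0) =
      frechet_derivative (\<lambda>z. g c' z undefined) (at (?\<phi> x)) (frechet_derivative ?\<phi> (at x) (v 0))"
    by simp
  then show "ext_d A 0 g c x v = ext_d A 0 g c' (coord c' (param c x))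
      (\<lambda>i. frechet_derivative ?\<phi> (at x) (v i))"
    using ext_d_0[OF assms c x'(1), of v undefined] ext_d_0[OF assms c' x'(2), of _ undefined] by simp
qed (simp add: ext_d_off)

lemma is_form_1_basis:
  assumes "is_form A 1 \<alpha>"
  shows "\<alpha> c x (\<lambda>_. p) = (\<Sum>b\<in>Basis. (p \<bullet> b) * \<alpha> c x (\<lambda>_. b))"
proof -
  note lin = linear_is_form_1[OF assms, of c x]
  have "\<alpha> c x (\<lambda>_. p) = \<alpha> c x (\<lambda>_. \<Sum>b\<in>Basis. (p \<bullet> b) *\<^sub>R b)"
    by (simp add: euclidean_representation)
  also have "\<dots> = (\<Sum>b\<in>Basis. \<alpha> c x (\<lambda>_. (p \<bullet> b) *\<^sub>R b))"
    by (rule linear_sum[OF lin])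
  also have "\<dots> = (\<Sum>b\<in>Basis. (p \<bullet> b) * \<alpha> c x (\<lambda>_. b))"
    by (intro sum.cong refl) (simp only: linear_scale[OF lin] real_scaleR_def)
  finally show ?thesis .
qed

text \<open>The second derivative of a change of coordinates exists and is symmetric. It is the symmetry that makes the
second order terms cancel when the exterior derivative of a 1-form is pulled back.\<close>

lemma transition_derivative:
  assumes c: "c \<in> A" "c' \<in> A" and x: "x \<in> coord c ` (cdom c \<inter> cdom c')"
  defines "\<phi> \<equiv> coord c' \<circ> param c"
  shows "((\<lambda>y. frechet_derivative \<phi> (at y) p \<bullet> b) has_derivative
      (\<lambda>q. frechet_derivative (\<lambda>y. frechet_derivative \<phi> (at y) p) (at x) q \<bullet> b)) (at x)"
    and "frechet_derivative (\<lambda>y. frechet_derivative \<phi> (at y) p) (at x) q =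
      frechet_derivative (\<lambda>y. frechet_derivative \<phi> (at y) q) (at x) p"
proof -
  let ?O = "coord c ` (cdom c \<inter> cdom c')"
  note \<phi> = smooth_transition[OF c, folded \<phi>_def]
  have 1: "((\<lambda>y. frechet_derivative \<phi> (at y) p \<bullet> b) has_derivative
      (\<lambda>q. frechet_derivative (\<lambda>y. frechet_derivative \<phi> (at y) p) (at x) q \<bullet> b)) (at x)" for p b
    by (rule bounded_linear.has_derivative[OF bounded_linear_inner_left
          smooth_on_has_derivative[OF smooth_on_derivative[OF \<phi>] x]])
  have 2: "frechet_derivative (\<lambda>y. \<phi> y \<bullet> b) (at y) p = frechet_derivative \<phi> (at y) p \<bullet> b"
    if "y \<in> ?O" for y b p
    by (rule fun_cong[OF frechet_derivative_eqI[OF bounded_linear.has_derivative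
          [OF bounded_linear_inner_left smooth_on_has_derivative[OF \<phi> that]]]])
  have smooth: "smooth_on ?O (\<lambda>y. \<phi> y \<bullet> b)" for b
    by (rule smooth_on_bounded_linear[OF open_overlap[OF c] bounded_linear_inner_left \<phi>])
  have 3: "frechet_derivative (\<lambda>z. frechet_derivative (\<lambda>y. \<phi> y \<bullet> b) (at z) p) (at x) q =
      frechet_derivative (\<lambda>y. frechet_derivative \<phi> (at y) p) (at x) q \<bullet> b" for b p q
  proof -
    have "frechet_derivative (\<lambda>z. frechet_derivative (\<lambda>y. \<phi> y \<bullet> b) (at z) p) (at x) =
        frechet_derivative (\<lambda>y. frechet_derivative \<phi> (at y) p \<bullet> b) (at x)"
      by (rule frechet_derivative_cong_open[OF open_overlap[OF c] x 2])
    then show ?thesis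
      unfolding frechet_derivative_eqI[OF 1] by (rule fun_cong)
  qed
  show "((\<lambda>y. frechet_derivative \<phi> (at y) p \<bullet> b) has_derivative
      (\<lambda>q. frechet_derivative (\<lambda>y. frechet_derivative \<phi> (at y) p) (at x) q \<bullet> b)) (at x)"
    by (rule 1)
  show "frechet_derivative (\<lambda>y. frechet_derivative \<phi> (at y) p) (at x) q =
      frechet_derivative (\<lambda>y. frechet_derivative \<phi> (at y) q) (at x) p"
  proof (rule euclidean_eqI)
    show "frechet_derivative (\<lambda>y. frechet_derivative \<phi> (at y) p) (at x) q \<bullet> b =
        frechet_derivative (\<lambda>y. frechet_derivative \<phi> (at y) q) (at x) p \<bullet> b" for b
      unfolding 3[symmetric] by (rule mixed_derivatives_commute[OF open_overlap[OF c] x smooth])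
  qed
qed

text \<open>The coordinate invariance is the point. In the derivative of \<open>\<alpha>\<close> in the chart \<open>c\<close>, expressed through the
chart \<open>c'\<close>, the coefficients of \<open>\<alpha>\<close> contribute the wanted terms and the change of coordinates contributes
its second derivative; the latter is symmetric in the two vectors and drops out of the difference.\<close>

lemma is_form_ext_d_1:
  assumes "is_form A 1 \<alpha>"
  shows "is_form A 2 (ext_d A 1 \<alpha>)"
  unfolding is_form_def
proof (intro conjI ballI allI impI)
  let ?D = "\<lambda>c x p q. frechet_derivative (\<lambda>y. \<alpha> c y (\<lambda>_. p)) (at x) q"
  fix c assume c: "c \<in> A"
  show "alternating_form 2 (ext_d A 1 \<alpha> c x)" if x: "x \<in> ctarget c" for x
  proof -
    note D = is_form_has_derivative[OF assms c x]
    have lin1: "linear (?D c x p)" for p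
      by (rule has_derivative_linear[OF D])
    have lin2: "linear (\<lambda>p. ?D c x p q)" for q
    proof (rule linearI)
      have "(\<lambda>y. \<alpha> c y (\<lambda>_. p + p')) = (\<lambda>y. \<alpha> c y (\<lambda>_. p) + \<alpha> c y (\<lambda>_. p'))" for p p'
        using linear_add[OF linear_is_form_1[OF assms]] by auto
      then show "?D c x (p + p') q = ?D c x p q + ?D c x p' q" for p p'
        using frechet_derivative_eqI[OF has_derivative_add[OF D[of "\<lambda>_. p"] D[of "\<lambda>_. p'"]]] by simp
      have "(\<lambda>y. \<alpha> c y (\<lambda>_. r *\<^sub>R p)) = (\<lambda>y. r * \<alpha> c y (\<lambda>_. p))" for r p
        using linear_scale[OF linear_is_form_1[OF assms]] by auto
      then show "?D c x (r *\<^sub>R p) q = r *\<^sub>R ?D c x p q" for r p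
        using frechet_derivative_eqI[OF has_derivative_mult_right[OF D[of "\<lambda>_. p"], of r]] by simp
    qed
    have lin: "linear (\<lambda>u. ?D c x q u - ?D c x u q)" "linear (\<lambda>u. ?D c x u q - ?D c x q u)" for q
      by (intro linear_compose_sub lin1 lin2)+
    show ?thesis
      unfolding alternating_form_def ext_d_1[OF assms c x]
    proof (intro conjI allI impI)
      show "linear (\<lambda>u. ?D c x ((v(i := u)) 1) ((v(i := u)) 0) - ?D c x ((v(i := u)) 0) ((v(i := u)) 1))"
        if "i < 2" for i :: nat and v
        using lin[of "v 0"] lin[of "v 1"] that by (auto simp: less_2_cases_iff)
    qed (auto simp: less_2_cases_iff)
  qed
  have smooth: "smooth_on (ctarget c) (\<lambda>x. ?D c x (v 1) (v 0) + (- 1) * ?D c x (v 0) (v 1))" for v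
    by (intro smooth_on_add smooth_on_mult smooth_on_const smooth_on_derivative
        is_form_smooth[OF assms c] open_ctarget c)
  show "smooth_on (ctarget c) (\<lambda>x. ext_d A 1 \<alpha> c x v)" for v
    by (rule smooth_on_cong[OF open_ctarget[OF c] _ smooth[of v]]) (simp add: ext_d_1[OF assms c, unfolded One_nat_def])
  fix c' x and v :: "nat \<Rightarrow> 'e"
  assume c': "c' \<in> A" and x: "x \<in> coord c ` (cdom c \<inter> cdom c')"
  let ?\<phi> = "coord c' \<circ> param c"
  let ?T = "\<lambda>p. frechet_derivative ?\<phi> (at x) p"
  let ?H = "\<lambda>p q. frechet_derivative (\<lambda>y. frechet_derivative ?\<phi> (at y) p) (at x) q"
  have x': "x \<in> ctarget c" "?\<phi> x \<in> ctarget c'"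
    using x overlap_subset[of c c'] transition_in_ctarget[OF c x] by (blast, simp)
  have D: "?D c x p q = (\<Sum>b\<in>Basis. (?T p \<bullet> b) * ?D c' (?\<phi> x) b (?T q))
      + (\<Sum>b\<in>Basis. (?H p q \<bullet> b) * \<alpha> c' (?\<phi> x) (\<lambda>_. b))" for p q
  proof -
    have "frechet_derivative (\<lambda>y. \<alpha> c y (\<lambda>_. p)) (at x) =
        frechet_derivative (\<lambda>y. \<Sum>b\<in>Basis. (frechet_derivative ?\<phi> (at y) p \<bullet> b) * \<alpha> c' (?\<phi> y) (\<lambda>_. b)) (at x)"
    proof (rule frechet_derivative_cong_open[OF open_overlap[OF c c'] x])
      show "\<alpha> c y (\<lambda>_. p) =
          (\<Sum>b\<in>Basis. (frechet_derivative ?\<phi> (at y) p \<bullet> b) * \<alpha> c' (?\<phi> y) (\<lambda>_. b))"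
        if "y \<in> coord c ` (cdom c \<inter> cdom c')" for y
        unfolding is_form_pullback[OF assms c c' that] comp_def by (rule is_form_1_basis[OF assms])
    qed
    also have "\<dots> = (\<lambda>q. \<Sum>b\<in>Basis. (?T p \<bullet> b) * ?D c' (?\<phi> x) b (?T q)
        + (?H p q \<bullet> b) * \<alpha> c' (?\<phi> x) (\<lambda>_. b))"
      by (intro frechet_derivative_eqI has_derivative_sum has_derivative_mult
          transition_derivative(1)[OF c c' x]
          has_derivative_compose[OF smooth_on_has_derivative[OF smooth_transition[OF c c'] x]
            is_form_has_derivative[OF assms c' x'(2)]])
    finally show ?thesis
      by (simp add: sum.distrib)
  qed
  have D': "(\<Sum>b\<in>Basis. (p \<bullet> b) * ?D c' (?\<phi> x) b q) = ?D c' (?\<phi> x) p q" for p q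
  proof -
    have "frechet_derivative (\<lambda>y. \<alpha> c' y (\<lambda>_. p)) (at (?\<phi> x)) =
        frechet_derivative (\<lambda>y. \<Sum>b\<in>Basis. (p \<bullet> b) * \<alpha> c' y (\<lambda>_. b)) (at (?\<phi> x))"
      by (rule arg_cong[where f = "\<lambda>f. frechet_derivative f (at (?\<phi> x))"], rule ext,
          rule is_form_1_basis[OF assms])
    also have "\<dots> = (\<lambda>q. \<Sum>b\<in>Basis. (p \<bullet> b) * ?D c' (?\<phi> x) b q)"
      by (intro frechet_derivative_eqI has_derivative_sum has_derivative_mult_right
          is_form_has_derivative[OF assms c' x'(2)])
    finally show ?thesis
      by simp
  qed
  have "?D c x (v 1) (v 0) - ?D c x (v 0) (v 1) =
      ?D c' (?\<phi> x) (?T (v 1)) (?T (v 0)) - ?D c' (?\<phi> x) (?T (v 0)) (?T (v 1))"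
    unfolding D D' transition_derivative(2)[OF c c' x, of "v 1" "v 0"] by simp
  then show "ext_d A 1 \<alpha> c x v = ext_d A 1 \<alpha> c' (coord c' (param c x))
      (\<lambda>i. frechet_derivative ?\<phi> (at x) (v i))"
    using ext_d_1[OF assms c x'(1), of v] ext_d_1[OF assms c' x'(2), of "\<lambda>i. ?T (v i)"]
    by (simp only: comp_def)
qed (simp add: ext_d_off)

lemma skip_skip:
  assumes "j < i"
  shows "skip j (skip i v) = skip (i - 1) (skip j v)" "skip i v j = v j" "skip j v (i - 1) = v i"
  using assms by (auto simp: skip_def fun_eq_iff)

text \<open>The double sum runs over ordered pairs of removed entries. The two orders of removing the same pair contribute the
same second derivative with opposite signs.\<close>

lemma ext_d_ext_d:
  assumes "is_form A k \<omega>"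
  shows "ext_d A (Suc k) (ext_d A k \<omega>) = zero_form"
proof (intro ext)
  fix c x v
  show "ext_d A (Suc k) (ext_d A k \<omega>) c x v = zero_form c x v"
  proof (cases "c \<in> A \<and> x \<in> ctarget c")
    case False
    then show ?thesis
      by (simp add: ext_d_off zero_form_def)
  next
    case True
    then have c: "c \<in> A" and x: "x \<in> ctarget c"
      by auto
    define H where "H w p q = frechet_derivative (\<lambda>y. frechet_derivative (\<lambda>z. \<omega> c z w) (at y) p) (at x) q"
      for w p q
    have H_commute: "H w p q = H w q p" for w p q
      unfolding H_def by (rule mixed_derivatives_commute[OF open_ctarget[OF c] x is_form_smooth[OF assms c]])
    define t where "t i j = (-1) ^ (i + j) * H (skip j (skip i v)) (skip i v j) (v i)" for i j
    have inner: "frechet_derivative (\<lambda>y. ext_d A k \<omega> c y w) (at x) q =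
        (\<Sum>j\<le>k. (-1) ^ j * H (skip j w) (w j) q)" for w q
    proof -
      have "frechet_derivative (\<lambda>y. ext_d A k \<omega> c y w) (at x) =
          frechet_derivative (\<lambda>y. \<Sum>j\<le>k. (-1) ^ j *
            frechet_derivative (\<lambda>z. \<omega> c z (skip j w)) (at y) (w j)) (at x)"
        by (rule frechet_derivative_cong_open[OF open_ctarget[OF c] x]) (rule ext_d_apply[OF c])
      also have "\<dots> = (\<lambda>q. \<Sum>j\<le>k. (-1) ^ j * H (skip j w) (w j) q)"
        unfolding H_def
        by (intro frechet_derivative_eqI has_derivative_sum has_derivative_mult_right
            smooth_on_has_derivative[OF smooth_on_derivative x] is_form_smooth[OF assms c])
      finally show ?thesis
        by simp
    qed
    have "ext_d A (Suc k) (ext_d A k \<omega>) c x v = (\<Sum>i\<le>Suc k. \<Sum>j\<le>k. t i j)"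
      by (simp only: ext_d_apply[OF c x] inner t_def sum_distrib_left power_add mult.assoc)
    also have "\<dots> = (\<Sum>(i, j)\<in>{..Suc k} \<times> {..k}. t i j)"
      by (rule sum.cartesian_product)
    also have "\<dots> = (\<Sum>(i, j)\<in>{(i, j). i \<le> Suc k \<and> j < i}. t i j) + (\<Sum>(i, j)\<in>{(i, j). i \<le> j \<and> j \<le> k}. t i j)"
    proof -
      have "{..Suc k} \<times> {..k} = {(i, j). i \<le> Suc k \<and> j < i} \<union> {(i, j). i \<le> j \<and> j \<le> k}"
        by auto
      moreover have "finite {(i, j). i \<le> Suc k \<and> j < i}" "finite {(i, j). i \<le> j \<and> j \<le> k}"
        by (auto intro: finite_subset[of _ "{..Suc k} \<times> {..k}"])
      moreover have "{(i, j). i \<le> Suc k \<and> j < i} \<inter> {(i, j). i \<le> j \<and> j \<le> k} = {}"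
        by auto
      ultimately show ?thesis
        by (simp add: sum.union_disjoint)
    qed
    also have "(\<Sum>(i, j)\<in>{(i, j). i \<le> Suc k \<and> j < i}. t i j) =
        (\<Sum>(i, j)\<in>{(i, j). i \<le> j \<and> j \<le> k}. - t i j)"
    proof (rule sum.reindex_bij_witness[where i = "\<lambda>(i, j). (Suc j, i)" and j = "\<lambda>(i, j). (j, i - 1)"])
      fix ij assume "ij \<in> {(i, j). i \<le> Suc k \<and> j < i}"
      then obtain i j where ij: "ij = (i, j)" "i \<le> Suc k" "j < i"
        by auto
      then have "(-1::real) ^ (i + j) = - ((-1) ^ (j + (i - 1)))"
        by (cases i) (auto simp: add.commute)
      then show "(case (case ij of (i, j) \<Rightarrow> (j, i - 1)) of (i, j) \<Rightarrow> - t i j) = (case ij of (i, j) \<Rightarrow> t i j)"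
        using skip_skip[OF ij(3), of v] H_commute[of _ "v i" "v j"] by (simp add: ij(1) t_def)
    qed auto
    also have "\<dots> = - (\<Sum>(i, j)\<in>{(i, j). i \<le> j \<and> j \<le> k}. t i j)"
      by (simp add: sum_negf case_prod_unfold)
    finally show ?thesis
      by (simp add: zero_form_def)
  qed
qed

text \<open>The usual \<open>d(\<alpha> \<and> \<beta>) = d\<alpha> \<and> \<beta> - \<alpha> \<and> d\<beta>\<close>, written with the 1-form in front, since a 2-form
commutes with a 1-form.\<close>

lemma ext_d_wedge_1_1:
  assumes "is_form A 1 \<alpha>" "is_form A 1 \<beta>"
  shows "ext_d A 2 (wedge 1 1 \<alpha> \<beta>) c x v =
    wedge 1 2 \<beta> (ext_d A 1 \<alpha>) c x v - wedge 1 2 \<alpha> (ext_d A 1 \<beta>) c x v"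
proof (cases "c \<in> A \<and> x \<in> ctarget c")
  case False
  then show ?thesis
    by (auto simp: ext_d_off wedge_def)
next
  case True
  then have cx: "c \<in> A" "x \<in> ctarget c"
    by auto
  let ?D = "\<lambda>\<alpha> p. frechet_derivative (\<lambda>y. \<alpha> c y (\<lambda>_. p)) (at x)"
  have D: "frechet_derivative (\<lambda>y. wedge 1 1 \<alpha> \<beta> c y w) (at x) q =
      (\<alpha> c x (\<lambda>_. w 0) * ?D \<beta> (w 1) q + ?D \<alpha> (w 0) q * \<beta> c x (\<lambda>_. w 1)) -
      (\<alpha> c x (\<lambda>_. w 1) * ?D \<beta> (w 0) q + ?D \<alpha> (w 1) q * \<beta> c x (\<lambda>_. w 0))" for w q
    unfolding wedge_1_1_form[OF assms]
    by (rule fun_cong[OF frechet_derivative_eqI])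
      (intro has_derivative_diff has_derivative_mult is_form_has_derivative[OF assms(1) cx]
        is_form_has_derivative[OF assms(2) cx])
  have "{..2} = {0, 1, 2::nat}"
    by auto
  then have "ext_d A 2 (wedge 1 1 \<alpha> \<beta>) c x v =
      frechet_derivative (\<lambda>y. wedge 1 1 \<alpha> \<beta> c y (skip 0 v)) (at x) (v 0) -
      frechet_derivative (\<lambda>y. wedge 1 1 \<alpha> \<beta> c y (skip 1 v)) (at x) (v 1) +
      frechet_derivative (\<lambda>y. wedge 1 1 \<alpha> \<beta> c y (skip 2 v)) (at x) (v 2)"
    by (simp add: ext_d_apply[OF cx])
  moreover have skip: "skip 0 v 0 = v 1" "skip 0 v 1 = v 2" "skip 1 v 0 = v 0" "skip 1 v 1 = v 2"
    "skip 2 v 0 = v 0" "skip 2 v 1 = v 1"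
    by (simp_all add: skip_def numeral_2_eq_2)
  ultimately show ?thesis
    unfolding D wedge_1_2_form[OF assms(1) is_form_ext_d_1[OF assms(2)]]
      wedge_1_2_form[OF assms(2) is_form_ext_d_1[OF assms(1)]]
      ext_d_1[OF assms(1) cx] ext_d_1[OF assms(2) cx] skip
    by (simp only: algebra_simps)
qed

section \<open>Changing the forms of a transversely homographic structure\<close>

text \<open>At each point the quotient may be computed on any vector \<open>w\<close> with \<open>\<alpha>(w) \<noteq> 0\<close>. Freezing \<open>w\<close> near a
point gives smoothness, and pushing \<open>w\<close> forward by the change of coordinates gives invariance.\<close>

lemma quotient_of_proportional_forms:
  assumes "is_form A 1 \<theta>" "is_form A 1 \<alpha>"
    and nonzero: "\<And>c x. c \<in> A \<Longrightarrow> x \<in> ctarget c \<Longrightarrow> \<exists>w. \<alpha> c x (\<lambda>_. w) \<noteq> 0"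
    and proportional: "\<And>c x v w. c \<in> A \<Longrightarrow> x \<in> ctarget c \<Longrightarrow>
      \<theta> c x (\<lambda>_. v) * \<alpha> c x (\<lambda>_. w) = \<theta> c x (\<lambda>_. w) * \<alpha> c x (\<lambda>_. v)"
  obtains g where "is_form A 0 g" "\<And>c x v. \<theta> c x v = g c x v * \<alpha> c x v"
proof -
  define g :: "('m, 'e) form" where "g c x v = (if c \<in> A \<and> x \<in> ctarget c
    then let w = SOME w. \<alpha> c x (\<lambda>_. w) \<noteq> 0 in \<theta> c x (\<lambda>_. w) / \<alpha> c x (\<lambda>_. w) else 0)" for c x v
  have g: "g c x v = \<theta> c x (\<lambda>_. w) / \<alpha> c x (\<lambda>_. w)"
    if "c \<in> A" "x \<in> ctarget c" "\<alpha> c x (\<lambda>_. w) \<noteq> 0" for c x v w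
  proof -
    have "\<alpha> c x (\<lambda>_. SOME w. \<alpha> c x (\<lambda>_. w) \<noteq> 0) \<noteq> 0"
      using someI_ex[OF nonzero[OF that(1,2)]] .
    then show ?thesis
      using that proportional[OF that(1,2), of w "SOME w. \<alpha> c x (\<lambda>_. w) \<noteq> 0"]
      by (simp add: g_def Let_def frac_eq_eq)
  qed
  have \<theta>: "\<theta> c x v = g c x w * \<alpha> c x v" for c x v w
  proof (cases "c \<in> A \<and> x \<in> ctarget c")
    case True
    then obtain u where u: "\<alpha> c x (\<lambda>_. u) \<noteq> 0"
      using nonzero by blast
    have "\<theta> c x (\<lambda>_. v 0) * \<alpha> c x (\<lambda>_. u) = \<theta> c x (\<lambda>_. u) * \<alpha> c x (\<lambda>_. v 0)"
      using True by (intro proportional) auto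
    moreover have "g c x w = \<theta> c x (\<lambda>_. u) / \<alpha> c x (\<lambda>_. u)"
      using True u by (intro g) auto
    ultimately show ?thesis
      using u by (simp add: is_form_1[OF assms(1), of c x v] is_form_1[OF assms(2), of c x v]
        eq_divide_imp times_divide_eq_left)
  next
    case False
    then show ?thesis
      using is_form_off[OF assms(1), of c x v] is_form_off[OF assms(2), of c x v] by simp
  qed
  have "is_form A 0 g"
    unfolding is_form_def
  proof (intro conjI ballI allI impI)
    show "alternating_form 0 (g c x)" for c x
      by (simp add: alternating_form_def g_def)
    show "g c x v = 0" if "c \<notin> A \<or> x \<notin> ctarget c" for c x v
      using that by (auto simp: g_def)
    fix c assume c: "c \<in> A"
    show "smooth_on (ctarget c) (\<lambda>x. g c x v)" for v
    proof (rule smooth_on_local)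
      fix x assume x: "x \<in> ctarget c"
      obtain w where w: "\<alpha> c x (\<lambda>_. w) \<noteq> 0"
        using nonzero[OF c x] by blast
      let ?T = "ctarget c \<inter> (\<lambda>y. \<alpha> c y (\<lambda>_. w)) -` (- {0})"
      have "continuous_on (ctarget c) (\<lambda>y. \<alpha> c y (\<lambda>_. w))"
        using is_form_smooth[OF assms(2) c, of "\<lambda>_. w"] by (simp add: smooth_on_def flip: Ck_on.simps(1))
      then have T: "open ?T"
        using open_ctarget[OF c] by (intro continuous_open_preimage) auto
      have "smooth_on ?T (\<lambda>y. \<theta> c y (\<lambda>_. w) / \<alpha> c y (\<lambda>_. w))"
        using smooth_on_subset[OF is_form_smooth[OF assms(1) c], of ?T]
          smooth_on_subset[OF is_form_smooth[OF assms(2) c], of ?T]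
        by (intro smooth_on_divide[OF T]) auto
      then have "smooth_on ?T (\<lambda>y. g c y v)"
        by (rule smooth_on_cong[OF T, rotated]) (auto simp: g[OF c])
      with T x w show "\<exists>T. open T \<and> x \<in> T \<and> smooth_on T (\<lambda>y. g c y v)"
        by (intro exI[of _ ?T]) auto
    qed
    fix c' x and v :: "nat \<Rightarrow> 'e"
    assume c': "c' \<in> A" and x: "x \<in> coord c ` (cdom c \<inter> cdom c')"
    obtain w where w: "\<alpha> c x (\<lambda>_. w) \<noteq> 0"
      using nonzero[OF c] x overlap_subset[of c c'] by blast
    let ?x = "coord c' (param c x)" and ?w = "frechet_derivative (coord c' \<circ> param c) (at x) w"
    have "\<theta> c x (\<lambda>_. w) = \<theta> c' ?x (\<lambda>_. ?w)" "\<alpha> c x (\<lambda>_. w) = \<alpha> c' ?x (\<lambda>_. ?w)"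
      by (rule is_form_pullback[OF assms(1) c c' x], rule is_form_pullback[OF assms(2) c c' x])
    then show "g c x v = g c' ?x (\<lambda>i. frechet_derivative (coord c' \<circ> param c) (at x) (v i))"
      using w \<theta>[of c x "\<lambda>_. w" v]
        \<theta>[of c' ?x "\<lambda>_. ?w" "\<lambda>i. frechet_derivative (coord c' \<circ> param c) (at x) (v i)"]
      by simp
  qed
  then show thesis
    using \<theta> by (intro that) auto
qed

text \<open>The structure equations of a transversely homographic structure with \<open>\<alpha>\<close> and \<open>\<beta>\<close> named, because the
argument needs a \<open>\<gamma>\<close> for prescribed \<open>\<alpha>\<close> and \<open>\<beta>\<close>.\<close>

definition homographic_triple :: "('m, 'e) form \<Rightarrow> ('m, 'e) form \<Rightarrow> ('m, 'e) form \<Rightarrow> bool" where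
  "homographic_triple \<alpha> \<beta> \<gamma> \<longleftrightarrow> is_form A 1 \<alpha> \<and> is_form A 1 \<beta> \<and> is_form A 1 \<gamma> \<and>
    ext_d A 1 \<alpha> = wedge 1 1 \<alpha> \<beta> \<and> ext_d A 1 \<beta> = wedge 1 1 \<alpha> \<gamma> \<and> ext_d A 1 \<gamma> = wedge 1 1 \<beta> \<gamma>"

lemma ext_d_1_eqI:
  assumes "is_form A 1 \<theta>" "is_form A 1 \<alpha>" "is_form A 1 \<beta>"
    "\<And>c x v. c \<in> A \<Longrightarrow> x \<in> ctarget c \<Longrightarrow> ext_d A 1 \<theta> c x v =
      \<alpha> c x (\<lambda>_. v 0) * \<beta> c x (\<lambda>_. v 1) - \<alpha> c x (\<lambda>_. v 1) * \<beta> c x (\<lambda>_. v 0)"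
  shows "ext_d A 1 \<theta> = wedge 1 1 \<alpha> \<beta>"
  using assms(4) wedge_1_1_form[OF assms(2,3)]
  by (intro form_eqI[OF is_form_ext_d_1[OF assms(1)] is_form_wedge[OF assms(2,3)]]) simp

lemma ext_d_ext_d_0:
  assumes "is_form A 0 g"
  shows "ext_d A 1 (ext_d A 0 g) c x v = 0"
  using ext_d_ext_d[OF assms] by (simp add: zero_form_def)

text \<open>Passing from \<open>\<alpha>\<close> to \<open>f \<alpha>\<close> turns \<open>\<beta>\<close> into \<open>\<beta> - df / f\<close> and \<open>\<gamma>\<close> into \<open>\<gamma> / f\<close>. The reciprocal
is a function \<open>u\<close> of its own, and \<open>- df / f = f du\<close>, which avoids all divisions.\<close>

lemma homographic_triple_rescale:
  assumes "homographic_triple \<alpha> \<beta> \<gamma>" "is_form A 0 f" "is_form A 0 u"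
    and fu: "\<And>c x v. c \<in> A \<Longrightarrow> x \<in> ctarget c \<Longrightarrow> f c x v * u c x v = 1"
  shows "homographic_triple (\<lambda>c x v. f c x v * \<alpha> c x v)
    (\<lambda>c x v. \<beta> c x v + f c x v * ext_d A 0 u c x v) (\<lambda>c x v. u c x v * \<gamma> c x v)"
proof -
  have forms: "is_form A 1 \<alpha>" "is_form A 1 \<beta>" "is_form A 1 \<gamma>"
    and eqs: "ext_d A 1 \<alpha> = wedge 1 1 \<alpha> \<beta>" "ext_d A 1 \<beta> = wedge 1 1 \<alpha> \<gamma>" "ext_d A 1 \<gamma> = wedge 1 1 \<beta> \<gamma>"
    using assms(1) by (auto simp: homographic_triple_def)
  note du = is_form_ext_d_0[OF assms(3)]
  note fdu = is_form_scale[OF assms(2) du]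
  note forms' = is_form_scale[OF assms(2) forms(1)] is_form_add[OF forms(2) fdu]
    is_form_scale[OF assms(3) forms(3)]
  have f: "f c x w = f c x v" and u: "u c x w = u c x v" for c x v w
    using is_form_0[OF assms(2)] is_form_0[OF assms(3)] by auto
  have df: "ext_d A 0 f c x v = - (f c x w * f c x w * ext_d A 0 u c x v)"
    if c: "c \<in> A" and x: "x \<in> ctarget c" for c x v w
  proof -
    have "frechet_derivative (\<lambda>y. f c y w * u c y w) (at x) = frechet_derivative (\<lambda>y. 1) (at x)"
      using fu[OF c] by (intro frechet_derivative_cong_open[OF open_ctarget[OF c] x])
    then have "f c x w * ext_d A 0 u c x v + ext_d A 0 f c x v * u c x w = 0"
      unfolding ext_d_0[OF assms(2) c x, of v w] ext_d_0[OF assms(3) c x, of v w]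
        frechet_derivative_eqI[OF has_derivative_mult[OF is_form_has_derivative[OF assms(2) c x]
          is_form_has_derivative[OF assms(3) c x]]]
      by (simp add: fun_eq_iff)
    \<comment> \<open>multiplied by \<open>f\<close>, so that \<open>f u = 1\<close> can be used once more\<close>
    then have "f c x w * (f c x w * ext_d A 0 u c x v + ext_d A 0 f c x v * u c x w) = 0"
      by simp
    then have "f c x w * f c x w * ext_d A 0 u c x v + ext_d A 0 f c x v * (f c x w * u c x w) = 0"
      by (simp add: algebra_simps)
    then show ?thesis
      using fu[OF c x] by simp
  qed
  show ?thesis
    unfolding homographic_triple_def
  proof (intro conjI forms' ext_d_1_eqI)
    fix c x v assume c: "c \<in> A" and x: "x \<in> ctarget c"
    define F U where "F = f c x v" and "U = u c x v"
    have FU: "f c x w = F" "u c x w = U" for w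
      unfolding F_def U_def by (rule f, rule u)
    have FU1: "F * U = 1"
      unfolding F_def U_def by (rule fu[OF c x])
    have dF: "ext_d A 0 f c x w = - (F * F * ext_d A 0 u c x w)" for w
      unfolding F_def by (rule df[OF c x])
    show "ext_d A 1 (\<lambda>c x v. f c x v * \<alpha> c x v) c x v =
        f c x (\<lambda>_. v 0) * \<alpha> c x (\<lambda>_. v 0) * (\<beta> c x (\<lambda>_. v 1) + f c x (\<lambda>_. v 1) * ext_d A 0 u c x (\<lambda>_. v 1)) -
        f c x (\<lambda>_. v 1) * \<alpha> c x (\<lambda>_. v 1) * (\<beta> c x (\<lambda>_. v 0) + f c x (\<lambda>_. v 0) * ext_d A 0 u c x (\<lambda>_. v 0))"
      unfolding ext_d_scale[OF assms(2) forms(1)] eqs wedge_1_1_form[OF forms(1,2)] FU dF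
      by (simp add: algebra_simps)
    have cancel: "F * a * (U * b) = a * b" for a b
      using FU1 by (simp add: mult.assoc mult.left_commute[of U])
    show "ext_d A 1 (\<lambda>c x v. \<beta> c x v + f c x v * ext_d A 0 u c x v) c x v =
        f c x (\<lambda>_. v 0) * \<alpha> c x (\<lambda>_. v 0) * (u c x (\<lambda>_. v 1) * \<gamma> c x (\<lambda>_. v 1)) -
        f c x (\<lambda>_. v 1) * \<alpha> c x (\<lambda>_. v 1) * (u c x (\<lambda>_. v 0) * \<gamma> c x (\<lambda>_. v 0))"
      unfolding ext_d_add[OF forms(2) fdu] ext_d_scale[OF assms(2) du] eqs
        wedge_1_1_form[OF forms(1,3)] FU dF ext_d_ext_d_0[OF assms(3)] cancel
      by (simp add: algebra_simps)
    show "ext_d A 1 (\<lambda>c x v. u c x v * \<gamma> c x v) c x v =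
        (\<beta> c x (\<lambda>_. v 0) + f c x (\<lambda>_. v 0) * ext_d A 0 u c x (\<lambda>_. v 0)) * (u c x (\<lambda>_. v 1) * \<gamma> c x (\<lambda>_. v 1)) -
        (\<beta> c x (\<lambda>_. v 1) + f c x (\<lambda>_. v 1) * ext_d A 0 u c x (\<lambda>_. v 1)) * (u c x (\<lambda>_. v 0) * \<gamma> c x (\<lambda>_. v 0))"
      unfolding ext_d_scale[OF assms(3) forms(3)] eqs wedge_1_1_form[OF forms(2,3)] FU distrib_right cancel
      by (simp add: algebra_simps)
  qed
qed

text \<open>For a fixed \<open>\<alpha>\<close> without zeros, the forms \<open>\<beta>\<close> with \<open>d\<alpha> = \<alpha> \<and> \<beta>\<close> differ by multiples of \<open>\<alpha>\<close>. Replacing \<open>\<beta>\<close> by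
\<open>\<beta> + g \<alpha>\<close> forces \<open>\<gamma> - dg + g \<beta>\<close> as the new \<open>\<gamma>\<close>, up to a multiple of \<open>\<alpha>\<close>. Adding
\<open>g\<^sup>2 / 2\<close> times \<open>\<alpha>\<close> cancels the difference \<open>g \<alpha> \<and> dg - g\<^sup>2 \<alpha> \<and> \<beta>\<close> that would
otherwise remain between the two sides of the last structure equation.\<close>

lemma homographic_triple_shift:
  assumes "homographic_triple \<alpha> \<beta> \<gamma>" "is_form A 0 g"
  shows "homographic_triple \<alpha> (\<lambda>c x v. \<beta> c x v + g c x v * \<alpha> c x v)
    (\<lambda>c x v. \<gamma> c x v - ext_d A 0 g c x v
      + g c x v * (\<beta> c x v + 1 / 2 * (g c x v * \<alpha> c x v)))"
proof -
  have forms: "is_form A 1 \<alpha>" "is_form A 1 \<beta>" "is_form A 1 \<gamma>"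
    and eqs: "ext_d A 1 \<alpha> = wedge 1 1 \<alpha> \<beta>" "ext_d A 1 \<beta> = wedge 1 1 \<alpha> \<gamma>" "ext_d A 1 \<gamma> = wedge 1 1 \<beta> \<gamma>"
    using assms(1) by (auto simp: homographic_triple_def)
  note dg = is_form_ext_d_0[OF assms(2)]
  note g\<alpha> = is_form_scale[OF assms(2) forms(1)]
  note \<beta>' = is_form_add[OF forms(2) g\<alpha>]
  note \<kappa> = is_form_add[OF forms(2) is_form_cmult[OF g\<alpha>, of "1 / 2"]]
  note g\<kappa> = is_form_scale[OF assms(2) \<kappa>]
  note \<gamma>' = is_form_add[OF is_form_diff[OF forms(3) dg] g\<kappa>]
  show ?thesis
    unfolding homographic_triple_def
  proof (intro conjI forms(1) \<beta>' \<gamma>' ext_d_1_eqI)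
    fix c x v
    define G where "G = g c x v"
    have G: "g c x w = G" for w
      unfolding G_def by (rule is_form_0[OF assms(2)])
    show "ext_d A 1 \<alpha> c x v =
        \<alpha> c x (\<lambda>_. v 0) * (\<beta> c x (\<lambda>_. v 1) + g c x (\<lambda>_. v 1) * \<alpha> c x (\<lambda>_. v 1)) -
        \<alpha> c x (\<lambda>_. v 1) * (\<beta> c x (\<lambda>_. v 0) + g c x (\<lambda>_. v 0) * \<alpha> c x (\<lambda>_. v 0))"
      unfolding eqs wedge_1_1_form[OF forms(1,2)] G by (simp add: algebra_simps)
    show "ext_d A 1 (\<lambda>c x v. \<beta> c x v + g c x v * \<alpha> c x v) c x v =
        \<alpha> c x (\<lambda>_. v 0) * (\<gamma> c x (\<lambda>_. v 1) - ext_d A 0 g c x (\<lambda>_. v 1) + g c x (\<lambda>_. v 1) *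
          (\<beta> c x (\<lambda>_. v 1) + 1 / 2 * (g c x (\<lambda>_. v 1) * \<alpha> c x (\<lambda>_. v 1)))) -
        \<alpha> c x (\<lambda>_. v 1) * (\<gamma> c x (\<lambda>_. v 0) - ext_d A 0 g c x (\<lambda>_. v 0) + g c x (\<lambda>_. v 0) *
          (\<beta> c x (\<lambda>_. v 0) + 1 / 2 * (g c x (\<lambda>_. v 0) * \<alpha> c x (\<lambda>_. v 0))))"
      unfolding ext_d_add[OF forms(2) g\<alpha>] ext_d_scale[OF assms(2) forms(1)] eqs
        wedge_1_1_form[OF forms(1,2)] wedge_1_1_form[OF forms(1,3)] G
      by (simp add: algebra_simps)
    show "ext_d A 1 (\<lambda>c x v. \<gamma> c x v - ext_d A 0 g c x v
          + g c x v * (\<beta> c x v + 1 / 2 * (g c x v * \<alpha> c x v))) c x v =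
        (\<beta> c x (\<lambda>_. v 0) + g c x (\<lambda>_. v 0) * \<alpha> c x (\<lambda>_. v 0)) *
          (\<gamma> c x (\<lambda>_. v 1) - ext_d A 0 g c x (\<lambda>_. v 1) + g c x (\<lambda>_. v 1) *
          (\<beta> c x (\<lambda>_. v 1) + 1 / 2 * (g c x (\<lambda>_. v 1) * \<alpha> c x (\<lambda>_. v 1)))) -
        (\<beta> c x (\<lambda>_. v 1) + g c x (\<lambda>_. v 1) * \<alpha> c x (\<lambda>_. v 1)) *
          (\<gamma> c x (\<lambda>_. v 0) - ext_d A 0 g c x (\<lambda>_. v 0) + g c x (\<lambda>_. v 0) *
          (\<beta> c x (\<lambda>_. v 0) + 1 / 2 * (g c x (\<lambda>_. v 0) * \<alpha> c x (\<lambda>_. v 0))))"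
      unfolding ext_d_add[OF is_form_diff[OF forms(3) dg] g\<kappa>] ext_d_diff[OF forms(3) dg]
        ext_d_scale[OF assms(2) \<kappa>] ext_d_add[OF forms(2) is_form_cmult[OF g\<alpha>]] ext_d_cmult[OF g\<alpha>]
        ext_d_scale[OF assms(2) forms(1)] eqs ext_d_ext_d_0[OF assms(2)]
        wedge_1_1_form[OF forms(1,2)] wedge_1_1_form[OF forms(1,3)] wedge_1_1_form[OF forms(2,3)] G
      by (simp add: field_simps)
  qed
qed

lemma defining_form_tangent:
  "defining_form A F \<alpha> \<Longrightarrow> c \<in> A \<Longrightarrow> x \<in> ctarget c \<Longrightarrow> leaf_tangent F c x v \<longleftrightarrow> \<alpha> c x (\<lambda>_. v) = 0"
  by (simp add: defining_form_def)

lemma defining_form_nonzero: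
  "defining_form A F \<alpha> \<Longrightarrow> c \<in> A \<Longrightarrow> x \<in> ctarget c \<Longrightarrow> \<exists>w. \<alpha> c x (\<lambda>_. w) \<noteq> 0"
  unfolding defining_form_def by blast

text \<open>Two forms with the same kernel are proportional: the combination \<open>\<alpha>(w) v - \<alpha>(v) w\<close> lies in the common kernel.\<close>

lemma quotient_of_defining_forms:
  assumes "defining_form A F \<alpha>" "defining_form A F \<alpha>'"
  obtains f where "is_form A 0 f" "\<And>c x v. \<alpha>' c x v = f c x v * \<alpha> c x v"
proof -
  have forms: "is_form A 1 \<alpha>" "is_form A 1 \<alpha>'"
    using assms by (auto simp: defining_form_def)
  show thesis
  proof (rule quotient_of_proportional_forms[OF forms(2,1)])
    fix c x v w assume cx: "c \<in> A" "x \<in> ctarget c"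
    note lin = linear_is_form_1[OF forms(1), of c x] linear_is_form_1[OF forms(2), of c x]
    define u where "u = \<alpha> c x (\<lambda>_. w) *\<^sub>R v - \<alpha> c x (\<lambda>_. v) *\<^sub>R w"
    have "\<alpha> c x (\<lambda>_. u) = 0"
      unfolding u_def linear_diff[OF lin(1)] linear_scale[OF lin(1)] by simp
    then have "\<alpha>' c x (\<lambda>_. u) = 0"
      using defining_form_tangent[OF assms(1) cx] defining_form_tangent[OF assms(2) cx] by simp
    then show "\<alpha>' c x (\<lambda>_. v) * \<alpha> c x (\<lambda>_. w) = \<alpha>' c x (\<lambda>_. w) * \<alpha> c x (\<lambda>_. v)"
      unfolding u_def linear_diff[OF lin(2)] linear_scale[OF lin(2)] by (simp add: mult.commute)
  qed (use that defining_form_nonzero[OF assms(1)] in auto)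
qed

text \<open>The structure is given by some triple \<open>\<alpha>', \<beta>', \<gamma>'\<close>. Rescaling makes its first form equal to \<open>\<alpha>\<close>;
then the second one differs from \<open>\<beta>\<close> by a multiple of \<open>\<alpha>\<close>, because both solve the same structure equation,
and a shift makes it equal to \<open>\<beta>\<close>.\<close>

lemma homographic_triple_exists:
  assumes "transversely_homographic A F" "defining_form A F \<alpha>" "is_form A 1 \<beta>"
    and d\<alpha>: "ext_d A 1 \<alpha> = wedge 1 1 \<alpha> \<beta>"
  obtains \<gamma> where "homographic_triple \<alpha> \<beta> \<gamma>"
proof -
  obtain \<alpha>' \<beta>' \<gamma>' where def': "defining_form A F \<alpha>'" and triple: "homographic_triple \<alpha>' \<beta>' \<gamma>'"
    using assms(1) by (auto simp: transversely_homographic_def homographic_triple_def defining_form_def)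
  have \<alpha>: "is_form A 1 \<alpha>" and \<alpha>': "is_form A 1 \<alpha>'"
    using assms(2) def' by (auto simp: defining_form_def)
  obtain f where f: "is_form A 0 f" "\<And>c x v. \<alpha> c x v = f c x v * \<alpha>' c x v"
    by (rule quotient_of_defining_forms[OF def' assms(2)]) (rule that)
  obtain u where u: "is_form A 0 u" "\<And>c x v. \<alpha>' c x v = u c x v * \<alpha> c x v"
    by (rule quotient_of_defining_forms[OF assms(2) def']) (rule that)
  have fu: "f c x v * u c x v = 1" if cx: "c \<in> A" "x \<in> ctarget c" for c x v
  proof -
    obtain w where w: "\<alpha> c x (\<lambda>_. w) \<noteq> 0"
      using defining_form_nonzero[OF assms(2) cx] by blast
    have "f c x v = f c x (\<lambda>_. w)" "u c x v = u c x (\<lambda>_. w)"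
      by (rule is_form_0[OF f(1)], rule is_form_0[OF u(1)])
    moreover have "f c x (\<lambda>_. w) * u c x (\<lambda>_. w) * \<alpha> c x (\<lambda>_. w) = 1 * \<alpha> c x (\<lambda>_. w)"
      unfolding mult.assoc u(2)[symmetric] f(2)[symmetric] by simp
    ultimately show ?thesis
      using w by (simp only: mult_cancel_right) simp
  qed
  have "(\<lambda>c x v. f c x v * \<alpha>' c x v) = \<alpha>"
    by (intro ext) (rule f(2)[symmetric])
  note homographic_triple_rescale[OF triple f(1) u(1) fu, unfolded this]
  then obtain \<beta>1 \<gamma>1 where 1: "homographic_triple \<alpha> \<beta>1 \<gamma>1"
    by blast
  then have \<beta>1: "is_form A 1 \<beta>1" and d\<alpha>1: "ext_d A 1 \<alpha> = wedge 1 1 \<alpha> \<beta>1"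
    by (auto simp: homographic_triple_def)
  obtain g where g: "is_form A 0 g" "\<And>c x v. \<beta> c x v - \<beta>1 c x v = g c x v * \<alpha> c x v"
  proof (rule quotient_of_proportional_forms[OF is_form_diff[OF assms(3) \<beta>1] \<alpha>])
    fix c x v w
    have "wedge 1 1 \<alpha> \<beta> c x (\<lambda>i. if i = 0 then v else w) = wedge 1 1 \<alpha> \<beta>1 c x (\<lambda>i. if i = 0 then v else w)"
      using d\<alpha> d\<alpha>1 by simp
    then show "(\<beta> c x (\<lambda>_. v) - \<beta>1 c x (\<lambda>_. v)) * \<alpha> c x (\<lambda>_. w) =
        (\<beta> c x (\<lambda>_. w) - \<beta>1 c x (\<lambda>_. w)) * \<alpha> c x (\<lambda>_. v)"
      unfolding wedge_1_1_form[OF \<alpha> assms(3)] wedge_1_1_form[OF \<alpha> \<beta>1] by (simp add: algebra_simps)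
  qed (use defining_form_nonzero[OF assms(2)] in auto)
  have "(\<lambda>c x v. \<beta>1 c x v + g c x v * \<alpha> c x v) = \<beta>"
    unfolding g(2)[symmetric] by simp
  note homographic_triple_shift[OF 1 g(1), unfolded this]
  then show thesis
    by (rule that)
qed

section \<open>Families of forms\<close>

lemma form_dot_has_derivative:
  assumes "smooth_form_family A J k \<omega>" "open J" "t \<in> J"
  shows "((\<lambda>s. \<omega> s c x v) has_real_derivative form_dot \<omega> t c x v) (at t)"
proof (cases "c \<in> A \<and> x \<in> ctarget c")
  case True
  then have "smooth_on (J \<times> ctarget c) (\<lambda>(s, y). \<omega> s c y v)"
    using assms(1) by (simp add: smooth_form_family_def)
  then have "(\<lambda>(s, y). \<omega> s c y v) differentiable at (t, x)"
    by (rule smooth_on_differentiable) (use assms(3) True in simp)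
  from deriv_slice[OF this] show ?thesis
    by (simp add: form_dot_def)
next
  case False
  have "\<omega> s c x v = 0" if "s \<in> J" for s
    using is_form_off[of A k "\<omega> s" c x v] assms(1) False that by (auto simp: smooth_form_family_def)
  then have "((\<lambda>s. \<omega> s c x v) has_real_derivative 0) (at t)"
    by (intro has_field_derivative_transform_within_open[OF DERIV_const assms(2,3)]) simp
  then show ?thesis
    using DERIV_imp_deriv by (fastforce simp: form_dot_def)
qed

lemma is_form_form_dot:
  assumes "smooth_form_family A J k \<omega>" "open J" "t \<in> J"
  shows "is_form A k (form_dot \<omega> t)"
proof -
  have forms: "is_form A k (\<omega> s)" if "s \<in> J" for s
    using assms(1) that by (simp add: smooth_form_family_def)
  note D = form_dot_has_derivative[OF assms]
  have eq: "a = b" if "(f has_real_derivative a) (at t)" "(g has_real_derivative b) (at t)"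
    "\<And>s. s \<in> J \<Longrightarrow> f s = g s" for f g a b
    using DERIV_unique[OF that(2) has_field_derivative_transform_within_open[OF that(1) assms(2,3) that(3)]]
    by simp
  show ?thesis
    unfolding is_form_def
  proof (intro conjI ballI allI impI)
    show "alternating_form k (form_dot \<omega> t c x)" for c x
      unfolding alternating_form_def
    proof (intro conjI allI impI)
      show "form_dot \<omega> t c x v = form_dot \<omega> t c x w" if "\<forall>i<k. v i = w i" for v w
        using that by (intro eq[OF D D] is_form_cong[OF forms]) auto
      show "linear (\<lambda>u. form_dot \<omega> t c x (v(i := u)))" if i: "i < k" for i v
      proof (rule linearI)
        note lin = alternating_form_linear[OF is_form_alternating[OF forms] i]
        show "form_dot \<omega> t c x (v(i := p + q)) = form_dot \<omega> t c x (v(i := p)) + form_dot \<omega> t c x (v(i := q))"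
          for p q
          by (rule eq[OF D DERIV_add[OF D D]]) (rule linear_add[OF lin])
        show "form_dot \<omega> t c x (v(i := r *\<^sub>R p)) = r *\<^sub>R form_dot \<omega> t c x (v(i := p))" for r p
          unfolding real_scaleR_def
          by (rule eq[OF D DERIV_cmult[OF D]]) (rule linear_scale[OF lin, unfolded real_scaleR_def])
      qed
      show "form_dot \<omega> t c x v = 0" if "i < j \<and> j < k \<and> v i = v j" for v i j
        using that by (intro eq[OF D DERIV_const]) (blast intro: alternating_form_repeat[OF is_form_alternating[OF forms]])
    qed
    show "smooth_on (ctarget c) (\<lambda>x. form_dot \<omega> t c x v)" if "c \<in> A" for c v
      using smooth_on_deriv_slice[OF open_ctarget[OF that] assms(3), of "\<lambda>(s, y). \<omega> s c y v"] assms(1) that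
      by (simp add: smooth_form_family_def form_dot_def)
    show "form_dot \<omega> t c x v = form_dot \<omega> t c' (coord c' (param c x))
        (\<lambda>i. frechet_derivative (coord c' \<circ> param c) (at x) (v i))"
      if "c \<in> A" "c' \<in> A" "x \<in> coord c ` (cdom c \<inter> cdom c')" for c c' x v
      by (rule eq[OF D D]) (rule is_form_pullback[OF forms that])
    show "form_dot \<omega> t c x v = 0" if "c \<notin> A \<or> x \<notin> ctarget c" for c x v
      by (rule eq[OF D DERIV_const]) (rule is_form_off[OF forms that])
  qed
qed

lemma ext_d_form_dot:
  assumes "smooth_form_family A J k \<omega>" "open J" "t \<in> J"
  shows "((\<lambda>s. ext_d A k (\<omega> s) c x v) has_real_derivative ext_d A k (form_dot \<omega> t) c x v) (at t)"
proof (cases "c \<in> A \<and> x \<in> ctarget c")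
  case True
  then have c: "c \<in> A" and x: "x \<in> ctarget c"
    by auto
  have smooth: "smooth_on (J \<times> ctarget c) (\<lambda>(s, y). \<omega> s c y w)" for w
    using assms(1) c by (simp add: smooth_form_family_def)
  have "((\<lambda>s. frechet_derivative (\<lambda>y. \<omega> s c y w) (at x) p) has_real_derivative
      frechet_derivative (\<lambda>y. form_dot \<omega> t c y w) (at x) p) (at t)" for w p
    using deriv_frechet_derivative_commute[OF assms(2) open_ctarget[OF c] assms(3) x smooth[of w], of p]
    by (simp add: form_dot_def)
  then show ?thesis
    unfolding ext_d_apply[OF c x] by (intro DERIV_sum DERIV_cmult)
next
  case False
  then show ?thesis
    by (simp add: ext_d_off)
qed

text \<open>The primitive of \<open>\<beta>' \<and> d\<beta>\<close>, a prime standing for the derivative at \<open>t\<close>. The second conclusion uses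
\<open>d\<alpha>' = \<alpha>' \<and> \<beta> + \<alpha> \<and> \<beta>'\<close>, the derivative of the structure equation. The last one uses that
\<open>\<alpha> \<and> d\<beta> = 0\<close> at all times, as \<open>d(d\<alpha>) = 0\<close>; differentiated in time and combined with
\<open>d\<beta> = \<alpha> \<and> \<gamma>\<close>, this says \<open>\<alpha> \<and> \<eta> = 0\<close>.\<close>

lemma
  fixes \<alpha> \<beta> :: "real \<Rightarrow> ('m, 'e) form"
  assumes fam: "smooth_form_family A J 1 \<alpha>" "smooth_form_family A J 1 \<beta>"
    and J: "open J" "t \<in> J"
    and d\<alpha>: "\<And>s. s \<in> J \<Longrightarrow> ext_d A 1 (\<alpha> s) = wedge 1 1 (\<alpha> s) (\<beta> s)"
    and triple: "homographic_triple (\<alpha> t) (\<beta> t) \<gamma>"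
    and \<eta>_def: "\<eta> = (\<lambda>c x v. ext_d A 1 (form_dot \<beta> t) c x v - wedge 1 1 (form_dot \<alpha> t) \<gamma> c x v)"
  shows is_form_primitive: "is_form A 2 \<eta>"
    and ext_d_primitive: "ext_d A 2 \<eta> = wedge 1 2 (form_dot \<beta> t) (ext_d A 1 (\<beta> t))"
    and primitive_tangent: "\<And>c x v w. \<alpha> t c x (\<lambda>_. v 0) = 0 \<Longrightarrow> \<alpha> t c x (\<lambda>_. v 1) = 0 \<Longrightarrow>
      \<alpha> t c x (\<lambda>_. w) \<noteq> 0 \<Longrightarrow> \<eta> c x v = 0"
proof -
  let ?\<alpha> = "form_dot \<alpha> t" and ?\<beta> = "form_dot \<beta> t"
  have forms_s: "is_form A 1 (\<alpha> s)" "is_form A 1 (\<beta> s)" if "s \<in> J" for s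
    using fam that by (auto simp: smooth_form_family_def)
  note forms = forms_s[OF J(2)]
  note dots = is_form_form_dot[OF fam(1) J] is_form_form_dot[OF fam(2) J]
  have \<gamma>: "is_form A 1 \<gamma>" and d\<beta>: "ext_d A 1 (\<beta> t) = wedge 1 1 (\<alpha> t) \<gamma>"
    and d\<gamma>: "ext_d A 1 \<gamma> = wedge 1 1 (\<beta> t) \<gamma>"
    using triple by (auto simp: homographic_triple_def)
  note D\<alpha> = form_dot_has_derivative[OF fam(1) J]
  note D\<beta> = form_dot_has_derivative[OF fam(2) J]
  have d\<alpha>dot: "ext_d A 1 ?\<alpha> c x v =
      ?\<alpha> c x (\<lambda>_. v 0) * \<beta> t c x (\<lambda>_. v 1) - ?\<alpha> c x (\<lambda>_. v 1) * \<beta> t c x (\<lambda>_. v 0)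
      + (\<alpha> t c x (\<lambda>_. v 0) * ?\<beta> c x (\<lambda>_. v 1) - \<alpha> t c x (\<lambda>_. v 1) * ?\<beta> c x (\<lambda>_. v 0))" for c x v
  proof -
    have "((\<lambda>s. \<alpha> s c x (\<lambda>_. v 0) * \<beta> s c x (\<lambda>_. v 1) - \<alpha> s c x (\<lambda>_. v 1) * \<beta> s c x (\<lambda>_. v 0))
        has_real_derivative
        (?\<alpha> c x (\<lambda>_. v 0) * \<beta> t c x (\<lambda>_. v 1) + ?\<beta> c x (\<lambda>_. v 1) * \<alpha> t c x (\<lambda>_. v 0)) -
        (?\<alpha> c x (\<lambda>_. v 1) * \<beta> t c x (\<lambda>_. v 0) + ?\<beta> c x (\<lambda>_. v 0) * \<alpha> t c x (\<lambda>_. v 1))) (at t)"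
      by (intro DERIV_diff DERIV_mult D\<alpha> D\<beta>)
    then have "((\<lambda>s. ext_d A 1 (\<alpha> s) c x v) has_real_derivative
        (?\<alpha> c x (\<lambda>_. v 0) * \<beta> t c x (\<lambda>_. v 1) + ?\<beta> c x (\<lambda>_. v 1) * \<alpha> t c x (\<lambda>_. v 0)) -
        (?\<alpha> c x (\<lambda>_. v 1) * \<beta> t c x (\<lambda>_. v 0) + ?\<beta> c x (\<lambda>_. v 0) * \<alpha> t c x (\<lambda>_. v 1))) (at t)"
      by (rule has_field_derivative_transform_within_open[OF _ J])
        (simp only: d\<alpha> wedge_1_1_form[OF forms_s])
    from DERIV_unique[OF ext_d_form_dot[OF fam(1) J] this] show ?thesis
      by (simp add: algebra_simps)
  qed
  show \<eta>: "is_form A 2 \<eta>"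
    unfolding \<eta>_def
    by (rule is_form_diff[OF is_form_ext_d_1[OF dots(2)] is_form_wedge_1_1[OF dots(1) \<gamma>]])
  show "ext_d A 2 \<eta> = wedge 1 2 ?\<beta> (ext_d A 1 (\<beta> t))"
  proof (intro ext)
    fix c x and v :: "nat \<Rightarrow> 'e"
    have skip: "skip 0 v 0 = v 1" "skip 0 v 1 = v 2" "skip 1 v 0 = v 0" "skip 1 v 1 = v 2"
      "skip 2 v 0 = v 0" "skip 2 v 1 = v 1"
      by (simp_all add: skip_def numeral_2_eq_2)
    have "ext_d A 2 \<eta> c x v = - ext_d A 2 (wedge 1 1 ?\<alpha> \<gamma>) c x v"
      unfolding \<eta>_def
      using ext_d_ext_d[OF dots(2)]
      unfolding ext_d_diff[OF is_form_ext_d_1[OF dots(2)] is_form_wedge_1_1[OF dots(1) \<gamma>]]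
      by (simp add: zero_form_def numeral_2_eq_2)
    also have "\<dots> = wedge 1 2 ?\<alpha> (ext_d A 1 \<gamma>) c x v - wedge 1 2 \<gamma> (ext_d A 1 ?\<alpha>) c x v"
      unfolding ext_d_wedge_1_1[OF dots(1) \<gamma>] by simp
    also have "\<dots> = wedge 1 2 ?\<beta> (ext_d A 1 (\<beta> t)) c x v"
      unfolding wedge_1_2_form[OF dots(1) is_form_ext_d_1[OF \<gamma>]]
        wedge_1_2_form[OF \<gamma> is_form_ext_d_1[OF dots(1)]]
        wedge_1_2_form[OF dots(2) is_form_ext_d_1[OF forms(2)]]
      unfolding d\<alpha>dot d\<beta> d\<gamma> wedge_1_1_form[OF forms(1) \<gamma>] wedge_1_1_form[OF forms(2) \<gamma>] skip
      by (simp add: algebra_simps)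
    finally show "ext_d A 2 \<eta> c x v = wedge 1 2 ?\<beta> (ext_d A 1 (\<beta> t)) c x v" .
  qed
  show "\<eta> c x v = 0"
    if v: "\<alpha> t c x (\<lambda>_. v 0) = 0" "\<alpha> t c x (\<lambda>_. v 1) = 0" and w: "\<alpha> t c x (\<lambda>_. w) \<noteq> 0" for c x v w
  proof -
    \<comment> \<open>\<open>\<alpha> \<and> \<eta>\<close> is evaluated on the triple \<open>w, v 0, v 1\<close>, where it is \<open>\<alpha>(w) \<eta>(v 0, v 1)\<close>.\<close>
    define a where "a = (\<lambda>i. if i = 0 then w else v (i - 1))"
    have a: "a 0 = w" "a 1 = v 0" "a 2 = v 1" and
      skip: "skip 0 a 0 = v 0" "skip 0 a 1 = v 1" "skip 1 a 0 = w" "skip 1 a 1 = v 1"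
        "skip 2 a 0 = w" "skip 2 a 1 = v 0" "skip 0 a = v"
      by (auto simp: a_def skip_def fun_eq_iff)
    have zero: "\<alpha> s c x (\<lambda>_. w) * ext_d A 1 (\<beta> s) c x (skip 0 a)
        - \<alpha> s c x (\<lambda>_. v 0) * ext_d A 1 (\<beta> s) c x (skip 1 a)
        + \<alpha> s c x (\<lambda>_. v 1) * ext_d A 1 (\<beta> s) c x (skip 2 a) = 0" if s: "s \<in> J" for s
    proof -
      have "0 = wedge 1 2 (\<beta> s) (ext_d A 1 (\<alpha> s)) c x a - wedge 1 2 (\<alpha> s) (ext_d A 1 (\<beta> s)) c x a"
        using ext_d_wedge_1_1[OF forms_s[OF s], of c x a] ext_d_ext_d[OF forms_s(1)[OF s]] d\<alpha>[OF s]
        by (simp add: zero_form_def numeral_2_eq_2)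
      moreover have "wedge 1 2 (\<beta> s) (ext_d A 1 (\<alpha> s)) c x a = 0"
        unfolding wedge_1_2_form[OF forms_s(2)[OF s] is_form_ext_d_1[OF forms_s(1)[OF s]]]
        unfolding d\<alpha>[OF s] wedge_1_1_form[OF forms_s[OF s]] skip a
        by (simp add: algebra_simps)
      ultimately show ?thesis
        unfolding wedge_1_2_form[OF forms_s(1)[OF s] is_form_ext_d_1[OF forms_s(2)[OF s]]] a by simp
    qed
    note Dd\<beta> = ext_d_form_dot[OF fam(2) J, of c x]
    let ?d\<beta> = "\<lambda>i. ext_d A 1 (\<beta> t) c x (skip i a)" and ?d\<beta>dot = "\<lambda>i. ext_d A 1 ?\<beta> c x (skip i a)"
    have "((\<lambda>s. \<alpha> s c x (\<lambda>_. w) * ext_d A 1 (\<beta> s) c x (skip 0 a)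
        - \<alpha> s c x (\<lambda>_. v 0) * ext_d A 1 (\<beta> s) c x (skip 1 a)
        + \<alpha> s c x (\<lambda>_. v 1) * ext_d A 1 (\<beta> s) c x (skip 2 a)) has_real_derivative
        (?\<alpha> c x (\<lambda>_. w) * ?d\<beta> 0 + ?d\<beta>dot 0 * \<alpha> t c x (\<lambda>_. w))
        - (?\<alpha> c x (\<lambda>_. v 0) * ?d\<beta> 1 + ?d\<beta>dot 1 * \<alpha> t c x (\<lambda>_. v 0))
        + (?\<alpha> c x (\<lambda>_. v 1) * ?d\<beta> 2 + ?d\<beta>dot 2 * \<alpha> t c x (\<lambda>_. v 1))) (at t)"
      by (intro DERIV_add DERIV_diff DERIV_mult D\<alpha> Dd\<beta>)
    moreover have "((\<lambda>s. \<alpha> s c x (\<lambda>_. w) * ext_d A 1 (\<beta> s) c x (skip 0 a)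
        - \<alpha> s c x (\<lambda>_. v 0) * ext_d A 1 (\<beta> s) c x (skip 1 a)
        + \<alpha> s c x (\<lambda>_. v 1) * ext_d A 1 (\<beta> s) c x (skip 2 a)) has_real_derivative 0) (at t)"
      by (rule has_field_derivative_transform_within_open[OF DERIV_const J]) (simp only: zero)
    ultimately have "(?\<alpha> c x (\<lambda>_. w) * ?d\<beta> 0 + ?d\<beta>dot 0 * \<alpha> t c x (\<lambda>_. w))
        - (?\<alpha> c x (\<lambda>_. v 0) * ?d\<beta> 1 + ?d\<beta>dot 1 * \<alpha> t c x (\<lambda>_. v 0))
        + (?\<alpha> c x (\<lambda>_. v 1) * ?d\<beta> 2 + ?d\<beta>dot 2 * \<alpha> t c x (\<lambda>_. v 1)) = 0"
      by (rule DERIV_unique)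
    then have "\<alpha> t c x (\<lambda>_. w) * \<eta> c x v = 0"
      unfolding \<eta>_def d\<beta> wedge_1_1_form[OF forms(1) \<gamma>] wedge_1_1_form[OF dots(1) \<gamma>] skip v
      by (simp add: algebra_simps)
    with w show ?thesis
      by simp
  qed
qed

section \<open>The cohomology of the ideal\<close>

lemma is_form_zero: "is_form A k zero_form"
  by (simp add: is_form_def zero_form_def alternating_form_zero smooth_on_const)

lemma ext_d_zero: "ext_d A k zero_form = zero_form"
  by (simp add: ext_d_def zero_form_def fun_eq_iff)

lemma fol_ideal_diff:
  assumes "\<omega> \<in> fol_ideal A F k" "\<eta> \<in> fol_ideal A F k"
  shows "(\<lambda>c x v. \<omega> c x v - \<eta> c x v) \<in> fol_ideal A F k"
proof -
  have "is_form A k (\<lambda>c x v. \<omega> c x v - \<eta> c x v)"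
    using assms by (intro is_form_diff) (simp_all add: fol_ideal_def)
  then show ?thesis
    using assms by (simp add: fol_ideal_def)
qed

lemma fol_ideal_add:
  assumes "\<omega> \<in> fol_ideal A F k" "\<eta> \<in> fol_ideal A F k"
  shows "(\<lambda>c x v. \<omega> c x v + \<eta> c x v) \<in> fol_ideal A F k"
proof -
  have "is_form A k (\<lambda>c x v. \<omega> c x v + \<eta> c x v)"
    using assms by (intro is_form_add) (simp_all add: fol_ideal_def)
  then show ?thesis
    using assms by (simp add: fol_ideal_def)
qed

text \<open>Adding or subtracting the primitive \<open>\<eta>\<close> matches the primitives that relate a form to \<open>d\<eta>\<close> with those that
relate it to zero. That \<open>d\<eta>\<close> lies in the ideal is what makes its class a class at all.\<close>

lemma coh_class_exact:
  assumes \<eta>: "\<eta> \<in> fol_ideal A F k" and d\<eta>: "ext_d A k \<eta> \<in> fol_ideal A F (Suc k)"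
  shows "coh_class A F (Suc k) (ext_d A k \<eta>) = coh_class A F (Suc k) zero_form"
proof -
  have form\<eta>: "is_form A k \<eta>"
    using \<eta> by (simp add: fol_ideal_def)
  have "ext_d A k \<eta> \<in> ideal_cocycles A F (Suc k)"
    using d\<eta> ext_d_ext_d[OF form\<eta>] by (simp add: ideal_cocycles_def)
  moreover have "zero_form \<in> ideal_cocycles A F (Suc k)"
    using is_form_zero ext_d_zero by (simp add: ideal_cocycles_def fol_ideal_def zero_form_def)
  moreover have "(\<lambda>c x v. ext_d A k \<eta> c x v - \<omega> c x v) \<in> ext_d A k ` fol_ideal A F k \<longleftrightarrow>
      (\<lambda>c x v. zero_form c x v - \<omega> c x v) \<in> ext_d A k ` fol_ideal A F k" (is "?L \<longleftrightarrow> ?R") for \<omega>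
  proof
    assume ?L
    then obtain \<zeta> where \<zeta>: "\<zeta> \<in> fol_ideal A F k" "ext_d A k \<zeta> = (\<lambda>c x v. ext_d A k \<eta> c x v - \<omega> c x v)"
      by auto
    then have "is_form A k \<zeta>"
      by (simp add: fol_ideal_def)
    have "ext_d A k (\<lambda>c x v. \<zeta> c x v - \<eta> c x v) = (\<lambda>c x v. zero_form c x v - \<omega> c x v)"
      unfolding ext_d_diff[OF \<open>is_form A k \<zeta>\<close> form\<eta>] \<zeta>(2) by (simp add: zero_form_def)
    then show ?R
      by (rule image_eqI[OF sym fol_ideal_diff[OF \<zeta>(1) \<eta>]])
  next
    assume ?R
    then obtain \<zeta> where \<zeta>: "\<zeta> \<in> fol_ideal A F k" "ext_d A k \<zeta> = (\<lambda>c x v. zero_form c x v - \<omega> c x v)"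
      by auto
    then have "is_form A k \<zeta>"
      by (simp add: fol_ideal_def)
    have "ext_d A k (\<lambda>c x v. \<zeta> c x v + \<eta> c x v) = (\<lambda>c x v. ext_d A k \<eta> c x v - \<omega> c x v)"
      unfolding ext_d_add[OF \<open>is_form A k \<zeta>\<close> form\<eta>] \<zeta>(2) by (simp add: zero_form_def)
    then show ?L
      by (rule image_eqI[OF sym fol_ideal_add[OF \<zeta>(1) \<eta>]])
  qed
  ultimately show ?thesis
    by (auto simp: coh_class_def cohomologous_def ideal_coboundaries_def)
qed

end

theorem theorem12:
  fixes A :: "('m::{t2_space,second_countable_topology}, 'e::euclidean_space) chart set"
    and F\<^sub>0 :: "'m foliation" and F :: "real \<Rightarrow> 'm foliation" and \<epsilon> :: real
    and \<alpha> \<beta> :: "real \<Rightarrow> ('m, 'e) form"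
  assumes "smooth_atlas A"
    and "is_foliation A F\<^sub>0"
    and "transversely_homographic A F\<^sub>0"
    and "\<epsilon> > 0"
    and "smooth_foliation_family A {-\<epsilon><..<\<epsilon>} F"
    and "F 0 = F\<^sub>0"
    and "admissible_choice A {-\<epsilon><..<\<epsilon>} F \<alpha> \<beta>"
  shows "T_class A F \<beta> 0 = coh_class A F\<^sub>0 3 zero_form"
proof -
  interpret manifold A
    by unfold_locales (rule assms(1))
  let ?J = "{-\<epsilon><..<\<epsilon>}"
  have J: "open ?J" "0 \<in> ?J"
    using assms(4) by auto
  have fam: "smooth_form_family A ?J 1 \<alpha>" "smooth_form_family A ?J 1 \<beta>"
    and d\<alpha>: "\<And>s. s \<in> ?J \<Longrightarrow> ext_d A 1 (\<alpha> s) = wedge 1 1 (\<alpha> s) (\<beta> s)"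
    and def\<alpha>: "defining_form A F\<^sub>0 (\<alpha> 0)"
    using assms(6,7) J(2) by (auto simp: admissible_choice_def defining_form_family_def)
  have form\<alpha>: "is_form A 1 (\<alpha> 0)" and form\<beta>: "is_form A 1 (\<beta> 0)"
    using fam J(2) by (auto simp: smooth_form_family_def)
  obtain \<gamma> where \<gamma>: "homographic_triple (\<alpha> 0) (\<beta> 0) \<gamma>"
    by (rule homographic_triple_exists[OF assms(3) def\<alpha> form\<beta> d\<alpha>[OF J(2)]]) (rule that)
  then have form\<gamma>: "is_form A 1 \<gamma>" and d\<beta>: "ext_d A 1 (\<beta> 0) = wedge 1 1 (\<alpha> 0) \<gamma>"
    by (auto simp: homographic_triple_def)
  define \<eta> where "\<eta> = (\<lambda>c x v. ext_d A 1 (form_dot \<beta> 0) c x v - wedge 1 1 (form_dot \<alpha> 0) \<gamma> c x v)"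
  have form\<eta>: "is_form A 2 \<eta>"
    by (rule is_form_primitive[OF fam J d\<alpha> \<gamma> \<eta>_def])
  have d\<eta>: "ext_d A 2 \<eta> = wedge 1 2 (form_dot \<beta> 0) (ext_d A 1 (\<beta> 0))"
    by (rule ext_d_primitive[OF fam J d\<alpha> \<gamma> \<eta>_def])
  have "\<eta> \<in> fol_ideal A F\<^sub>0 2"
    unfolding fol_ideal_def
  proof (intro CollectI conjI ballI allI impI form\<eta>)
    fix c x and v :: "nat \<Rightarrow> 'e"
    assume cx: "c \<in> A" "x \<in> ctarget c" and "\<forall>i<2. leaf_tangent F\<^sub>0 c x (v i)"
    then have "\<alpha> 0 c x (\<lambda>_. v 0) = 0" "\<alpha> 0 c x (\<lambda>_. v 1) = 0"
      using defining_form_tangent[OF def\<alpha> cx] by auto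
    moreover obtain w where "\<alpha> 0 c x (\<lambda>_. w) \<noteq> 0"
      using defining_form_nonzero[OF def\<alpha> cx] by blast
    ultimately show "\<eta> c x v = 0"
      by (intro primitive_tangent[OF fam J d\<alpha> \<gamma> \<eta>_def, of c x v w])
  qed
  moreover have "ext_d A 2 \<eta> \<in> fol_ideal A F\<^sub>0 3"
    unfolding fol_ideal_def
  proof (intro CollectI conjI ballI allI impI)
    note d\<beta>_form = is_form_ext_d_1[OF form\<beta>]
    note \<beta>dot_form = is_form_form_dot[OF fam(2) J]
    show "is_form A 3 (ext_d A 2 \<eta>)"
    proof -
      have "(1::nat) + 2 = 3"
        by simp
      then show ?thesis
        unfolding d\<eta> using is_form_wedge[OF \<beta>dot_form d\<beta>_form] by (simp only:)
    qed
    fix c x and v :: "nat \<Rightarrow> 'e"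
    assume cx: "c \<in> A" "x \<in> ctarget c" and "\<forall>i<3. leaf_tangent F\<^sub>0 c x (v i)"
    then have "\<alpha> 0 c x (\<lambda>_. v i) = 0" if "i < 3" for i
      using defining_form_tangent[OF def\<alpha> cx] that by auto
    then show "ext_d A 2 \<eta> c x v = 0"
      unfolding d\<eta> wedge_1_2_form[OF \<beta>dot_form d\<beta>_form]
      unfolding d\<beta> wedge_1_1_form[OF form\<alpha> form\<gamma>]
      by (simp add: skip_def)
  qed
  ultimately show ?thesis
    using coh_class_exact[of \<eta> F\<^sub>0 2] assms(6) by (simp add: T_class_def d\<eta>)
qed

end
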